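(* Consider the system $F_\alpha(x,u^{(s)},\widetilde u^{(s)})=0$, $\alpha=1,\ldots,m$. Suppose it admits the operator $$X=\sum_{i=1}^n\xi^i\frac{\partial}{\partial x^i}+\sum_{\beta=1}^m\eta_\beta\frac{\partial}{\partial u^\beta}+\sum_{\widetilde\beta=1}^{\widetilde m}\widetilde\eta_{\widetilde\beta}\frac{\partial}{\partial\widetilde u^{\widetilde\beta}},$$ a generator of a point transformation group, i.e. $\xi^i=\xi^i(x,u,\widetilde u)$, $\eta_\beta=\eta_\beta(x,u,\widetilde u)$, $\widetilde\eta_{\widetilde\beta}=\widetilde\eta_{\widetilde\beta}(x,u,\widetilde u)$, and $$\mathrm{Pr}^{(s)}X(F_\alpha)=\sum_{\beta=1}^m\lambda_{\alpha\beta}(x,u^{(s)},\widetilde u^{(s)})\,F_\beta,\qquad \alpha=1,\ldots,m,$$ for some differential functions $\lambda_{\alpha\beta}$. Then the adjoint equations $F^\star_\alpha=0$, $\widetilde F^\star_{\widetilde\alpha}=0$, considered together with the system $F_\alpha=0$, admit the generator of symmetries $$Y=X+\sum_{\beta=1}^m\eta^\star_\beta\frac{\partial}{\partial v^\beta}+\sum_{\widetilde\beta=1}^{\widetilde m}\widetilde\eta^\star_{\widetilde\beta}\frac{\partial}{\partial\widetilde v^{\widetilde\beta}},$$ where $\eta^\star_\beta,\widetilde\eta^\star_{\widetilde\beta}$ are differential functions satisfying, for $\beta=1,\ldots,m$, $$\eta^\star_\beta+\sum_{\widetilde\alpha=1}^{\widetilde m}\widetilde\eta^\star_{\widetilde\alpha}=-\Big[\sum_{\alpha=1}^m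 v^\alpha\lambda_{\alpha\beta}+v^\beta\sum_{i=1}^nD_{x^i}(\xi^i)+\Big(\sum_{\widetilde\alpha=1}^{\widetilde m}\widetilde v^{\widetilde\alpha}\Big)\sum_{\alpha=1}^m\lambda_{\alpha\beta}+\Big(\sum_{\widetilde\alpha=1}^{\widetilde m}\widetilde v^{\widetilde\alpha}\Big)\Big(\sum_{i=1}^nD_{x^i}(\xi^i)\Big)\Big].$$ This relation is satisfied in particular for $$\eta^\star_\beta=-\Big[\sum_{\alpha=1}^m\Big(v^\alpha+\sum_{\widetilde\alpha=1}^{\widetilde m}\widetilde v^{\widetilde\alpha}\Big)\lambda_{\alpha\beta}+v^\beta\sum_{i=1}^nD_{x^i}(\xi^i)\Big],\qquad \widetilde\eta^\star_{\widetilde\alpha}=-\widetilde v^{\widetilde\alpha}\sum_{i=1}^nD_{x^i}(\xi^i).$$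
   Context: Independent variables: $x=(x^1,\ldots,x^n)$. Dependent variables: $u=(u^1,\ldots,u^m)$ and $\widetilde u=(\widetilde u^1,\ldots,\widetilde u^{\widetilde m})$, functions of $x$. The number of equations $m$ is less than or equal to the number $m+\widetilde m$ of dependent variables ($\widetilde m\ge 0$; empty sums are $0$). $u^{(s)}$ denotes the tuple of the $u^j$ and all their partial derivatives up to order $s$; similarly $\widetilde u^{(s)}$. A differential function is a smooth function of $x$ and finitely many derivatives of the dependent variables; the $F_\alpha$ are differential functions. $D_{x^i}$ is the total derivative with respect to $x^i$. For a dependent variable $z$, the variational derivative is $\frac{\delta}{\delta z}=\sum_J(-1)^{|J|}D_J\frac{\partial}{\partial z_J}$, where $J=(j_1,\ldots,j_n)$ runs over multi-indices, $D_J=D_{x^1}^{j_1}\cdots D_{x^n}^{j_n}$ and $z_J=\partial^{|J|}z/\partial (x^1)^{j_1}\cdots\partial(x^n)^{j_n}$. Adjoint equations: introduce new dependent variables $v=(v^1,\ldots,v^m)$ and $\widetilde v=(\widetilde v^1,\ldots,\widetilde v^{\widetilde m})$, functions of $x$, and set $$F^\star_\alpha=\frac{\delta L}{\delta u^\alpha},\qquad \widetilde F^\star_{\widetilde\alpha}=\frac{\delta L}{\delta\widetilde u^{\widetilde\alpha}},\qquad L=\sum_{\beta=1}^m v^\beta F_\beta+\Big(\sum_{\widetilde\beta=1}^{\widetilde m}\widetilde v^{\widetilde\beta}\Big)\Big(\sum_{\nu=1}^m F_\nu\Big).$$ The adjoint equations are $F^\star_\alpha=0$ for $\alpha=1,\ldots,m$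 and $\widetilde F^\star_{\widetilde\alpha}=0$ for $\widetilde\alpha=1,\ldots,\widetilde m$. Prolongation: for an operator $Z=\sum_i\xi^i\partial_{x^i}+\sum_z\zeta^z\partial_z$ ($z$ running over the dependent variables, coefficients being differential functions), $\mathrm{Pr}\,Z=\sum_i\xi^iD_{x^i}+\sum_z\sum_J D_J(W^z)\frac{\partial}{\partial z_J}$ with $W^z=\zeta^z-\sum_i\xi^i z_{x^i}$; $\mathrm{Pr}^{(s)}Z$ is its restriction to differential functions of order at most $s$. A system of equations $E_1=\cdots=E_r=0$ admits $Z$ as a generator of symmetries if each $\mathrm{Pr}\,Z(E_k)$ vanishes at all points of jet space where all $E_1,\ldots,E_r$ and all their total derivatives vanish. *)

theory Defs
  imports "HOL-Analysis.Analysis"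
begin

section \<open>Jet space and differential functions\<close>

text \<open>
  Independent variables are numbered \<open>0, \<dots>, n - 1\<close>; a multi-index is a function
  \<open>J :: nat \<Rightarrow> nat\<close> vanishing from \<open>n\<close> on. \<open>Jet z J\<close> is the jet coordinate
  \<open>z\<^sub>J\<close> of the dependent variable \<open>z\<close>; in particular \<open>Jet z (\<lambda>_. 0)\<close> is \<open>z\<close> itself.
\<close>

datatype 'z jet_coord = Indep nat | Jet 'z "nat \<Rightarrow> nat"

type_synonym 'z jet = "'z jet_coord \<Rightarrow> real"

definition multi_indices :: "nat \<Rightarrow> (nat \<Rightarrow> nat) set" where
  "multi_indices n = {J. \<forall>i\<ge>n. J i = 0}"

definition mi_size :: "nat \<Rightarrow> (nat \<Rightarrow> nat) \<Rightarrow> nat" where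
  "mi_size n J = (\<Sum>i<n. J i)"

definition jet_coords :: "nat \<Rightarrow> 'z set \<Rightarrow> nat \<Rightarrow> 'z jet_coord set" where
  "jet_coords n Z s =
     Indep ` {..<n} \<union> {Jet z J | z J. z \<in> Z \<and> J \<in> multi_indices n \<and> mi_size n J \<le> s}"

definition partial_deriv :: "'z jet_coord \<Rightarrow> ('z jet \<Rightarrow> real) \<Rightarrow> 'z jet \<Rightarrow> real" where
  "partial_deriv c f p = deriv (\<lambda>t. f (p(c := t))) (p c)"

text \<open>
  Smooth functions on an open set \<open>\<Omega>\<close> of jet space that depend only on the independent variables
  and on the derivatives of order at most \<open>s\<close> of the dependent variables in \<open>Z\<close>. Smoothness in
  these finitely many coordinates means that all iterated partial derivatives exist and are
  continuous (jet space carries the product topology). Values outside \<open>\<Omega>\<close> are irrelevant.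
\<close>

definition diff_fun_order ::
  "'z jet set \<Rightarrow> nat \<Rightarrow> 'z set \<Rightarrow> nat \<Rightarrow> ('z jet \<Rightarrow> real) \<Rightarrow> bool" where
  "diff_fun_order \<Omega> n Z s f \<longleftrightarrow>
     (\<forall>p\<in>\<Omega>. \<forall>q\<in>\<Omega>. (\<forall>c\<in>jet_coords n Z s. p c = q c) \<longrightarrow> f p = f q) \<and>
     (\<forall>cs. set cs \<subseteq> jet_coords n Z s \<longrightarrow>
        continuous_on \<Omega> (foldr partial_deriv cs f) \<and>
        (\<forall>p\<in>\<Omega>. \<forall>c\<in>jet_coords n Z s.
           (\<lambda>t. foldr partial_deriv cs f (p(c := t))) field_differentiable at (p c)))"

definition diff_fun :: "'z jet set \<Rightarrow> nat \<Rightarrow> 'z set \<Rightarrow> ('z jet \<Rightarrow> real) \<Rightarrow> bool" where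
  "diff_fun \<Omega> n Z f \<longleftrightarrow> (\<exists>s. diff_fun_order \<Omega> n Z s f)"


section \<open>Total and variational derivatives, prolongation, symmetries\<close>

text \<open>
  The sums over multi-indices below have only finitely many nonzero terms at every point of \<open>\<Omega>\<close>
  when the functions involved are differential functions on the open set \<open>\<Omega>\<close>. \<open>Z\<close> is always the
  finite set of dependent variables under consideration.
\<close>

definition total_deriv ::
  "nat \<Rightarrow> 'z set \<Rightarrow> nat \<Rightarrow> ('z jet \<Rightarrow> real) \<Rightarrow> 'z jet \<Rightarrow> real" where
  "total_deriv n Z i f p =
     partial_deriv (Indep i) f p +
     (\<Sum>z\<in>Z. \<Sum>\<^sub>\<infinity>J\<in>multi_indices n. p (Jet z (J(i := Suc (J i)))) * partial_deriv (Jet z J) f p)"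

definition total_deriv_mi ::
  "nat \<Rightarrow> 'z set \<Rightarrow> (nat \<Rightarrow> nat) \<Rightarrow> ('z jet \<Rightarrow> real) \<Rightarrow> 'z jet \<Rightarrow> real" where
  "total_deriv_mi n Z J = foldr (\<lambda>i. total_deriv n Z i ^^ J i) [0..<n]"

definition variational_deriv ::
  "nat \<Rightarrow> 'z set \<Rightarrow> 'z \<Rightarrow> ('z jet \<Rightarrow> real) \<Rightarrow> 'z jet \<Rightarrow> real" where
  "variational_deriv n Z z f p =
     (\<Sum>\<^sub>\<infinity>J\<in>multi_indices n.
        (-1) ^ mi_size n J * total_deriv_mi n Z J (partial_deriv (Jet z J) f) p)"

text \<open>An operator \<open>\<Sum>\<^sub>i \<xi>\<^sup>i \<partial>/\<partial>x\<^sup>i + \<Sum>\<^sub>z \<zeta>\<^sup>z \<partial>/\<partial>z\<close> is given by its coefficient families \<open>\<xi>\<close> and \<open>\<zeta>\<close>.\<close>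

definition characteristic ::
  "nat \<Rightarrow> (nat \<Rightarrow> 'z jet \<Rightarrow> real) \<Rightarrow> ('z \<Rightarrow> 'z jet \<Rightarrow> real) \<Rightarrow> 'z \<Rightarrow> 'z jet \<Rightarrow> real" where
  "characteristic n \<xi> \<zeta> z p = \<zeta> z p - (\<Sum>i<n. \<xi> i p * p (Jet z ((\<lambda>_. 0)(i := 1))))"

definition prolong ::
  "nat \<Rightarrow> 'z set \<Rightarrow> (nat \<Rightarrow> 'z jet \<Rightarrow> real) \<Rightarrow> ('z \<Rightarrow> 'z jet \<Rightarrow> real) \<Rightarrow>
   ('z jet \<Rightarrow> real) \<Rightarrow> 'z jet \<Rightarrow> real" where
  "prolong n Z \<xi> \<zeta> f p =
     (\<Sum>i<n. \<xi> i p * total_deriv n Z i f p) +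
     (\<Sum>z\<in>Z. \<Sum>\<^sub>\<infinity>J\<in>multi_indices n.
        total_deriv_mi n Z J (characteristic n \<xi> \<zeta> z) p * partial_deriv (Jet z J) f p)"

text \<open>The system \<open>E = 0\<close>, \<open>E \<in> \<E>\<close>, on \<open>\<Omega>\<close> admits the operator as a generator of symmetries.\<close>

definition admits_symmetry ::
  "'z jet set \<Rightarrow> nat \<Rightarrow> 'z set \<Rightarrow> ('z jet \<Rightarrow> real) set \<Rightarrow>
   (nat \<Rightarrow> 'z jet \<Rightarrow> real) \<Rightarrow> ('z \<Rightarrow> 'z jet \<Rightarrow> real) \<Rightarrow> bool" where
  "admits_symmetry \<Omega> n Z \<E> \<xi> \<zeta> \<longleftrightarrow>
     (\<forall>E\<in>\<E>. \<forall>p\<in>\<Omega>.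
        (\<forall>G\<in>\<E>. \<forall>J\<in>multi_indices n. total_deriv_mi n Z J G p = 0) \<longrightarrow>
        prolong n Z \<xi> \<zeta> E p = 0)"


section \<open>The adjoint system\<close>

text \<open>\<open>U\<close>, \<open>Ut\<close>, \<open>V\<close>, \<open>Vt\<close> stand for \<open>u\<close>, \<open>u~\<close>, \<open>v\<close>, \<open>v~\<close>, with indices counted from 0.\<close>

datatype depvar = U nat | Ut nat | V nat | Vt nat

definition state_vars :: "nat \<Rightarrow> nat \<Rightarrow> depvar set" where
  "state_vars m mt = U ` {..<m} \<union> Ut ` {..<mt}"

definition all_vars :: "nat \<Rightarrow> nat \<Rightarrow> depvar set" where
  "all_vars m mt = state_vars m mt \<union> V ` {..<m} \<union> Vt ` {..<mt}"

abbreviation dep_val :: "'z \<Rightarrow> 'z jet \<Rightarrow> real" where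
  "dep_val z p \<equiv> p (Jet z (\<lambda>_. 0))"

definition adjoint_lagrangian ::
  "nat \<Rightarrow> nat \<Rightarrow> (nat \<Rightarrow> depvar jet \<Rightarrow> real) \<Rightarrow> depvar jet \<Rightarrow> real" where
  "adjoint_lagrangian m mt F p =
     (\<Sum>\<beta><m. dep_val (V \<beta>) p * F \<beta> p) + (\<Sum>\<beta><mt. dep_val (Vt \<beta>) p) * (\<Sum>\<nu><m. F \<nu> p)"

definition adjoint_F ::
  "nat \<Rightarrow> nat \<Rightarrow> nat \<Rightarrow> (nat \<Rightarrow> depvar jet \<Rightarrow> real) \<Rightarrow> nat \<Rightarrow> depvar jet \<Rightarrow> real" where
  "adjoint_F n m mt F \<alpha> =
     variational_deriv n (all_vars m mt) (U \<alpha>) (adjoint_lagrangian m mt F)"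

definition adjoint_Ft ::
  "nat \<Rightarrow> nat \<Rightarrow> nat \<Rightarrow> (nat \<Rightarrow> depvar jet \<Rightarrow> real) \<Rightarrow> nat \<Rightarrow> depvar jet \<Rightarrow> real" where
  "adjoint_Ft n m mt F \<alpha> =
     variational_deriv n (all_vars m mt) (Ut \<alpha>) (adjoint_lagrangian m mt F)"

definition combined_system ::
  "nat \<Rightarrow> nat \<Rightarrow> nat \<Rightarrow> (nat \<Rightarrow> depvar jet \<Rightarrow> real) \<Rightarrow> (depvar jet \<Rightarrow> real) set" where
  "combined_system n m mt F =
     F ` {..<m} \<union> adjoint_F n m mt F ` {..<m} \<union> adjoint_Ft n m mt F ` {..<mt}"

text \<open>
  The coefficient families of \<open>X\<close> and \<open>Y\<close> in the directions of the dependent variables. The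
  values of \<open>X_coeffs\<close> at \<open>V\<close> and \<open>Vt\<close> play no role: \<open>X\<close> is prolonged over \<open>state_vars\<close>.
\<close>

fun X_coeffs ::
  "(nat \<Rightarrow> depvar jet \<Rightarrow> real) \<Rightarrow> (nat \<Rightarrow> depvar jet \<Rightarrow> real) \<Rightarrow>
   depvar \<Rightarrow> depvar jet \<Rightarrow> real" where
  "X_coeffs \<eta> \<eta>t (U \<beta>) = \<eta> \<beta>"
| "X_coeffs \<eta> \<eta>t (Ut \<beta>) = \<eta>t \<beta>"
| "X_coeffs \<eta> \<eta>t (V \<beta>) = (\<lambda>_. 0)"
| "X_coeffs \<eta> \<eta>t (Vt \<beta>) = (\<lambda>_. 0)"

fun Y_coeffs ::
  "(nat \<Rightarrow> depvar jet \<Rightarrow> real) \<Rightarrow> (nat \<Rightarrow> depvar jet \<Rightarrow> real) \<Rightarrow>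
   (nat \<Rightarrow> depvar jet \<Rightarrow> real) \<Rightarrow> (nat \<Rightarrow> depvar jet \<Rightarrow> real) \<Rightarrow>
   depvar \<Rightarrow> depvar jet \<Rightarrow> real" where
  "Y_coeffs \<eta> \<eta>t \<eta>s \<eta>ts (U \<beta>) = \<eta> \<beta>"
| "Y_coeffs \<eta> \<eta>t \<eta>s \<eta>ts (Ut \<beta>) = \<eta>t \<beta>"
| "Y_coeffs \<eta> \<eta>t \<eta>s \<eta>ts (V \<beta>) = \<eta>s \<beta>"
| "Y_coeffs \<eta> \<eta>t \<eta>s \<eta>ts (Vt \<beta>) = \<eta>ts \<beta>"

definition total_div ::
  "nat \<Rightarrow> 'z set \<Rightarrow> (nat \<Rightarrow> 'z jet \<Rightarrow> real) \<Rightarrow> 'z jet \<Rightarrow> real" where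
  "total_div n Z \<xi> p = (\<Sum>i<n. total_deriv n Z i (\<xi> i) p)"

text \<open>The relation imposed on the differential functions \<open>\<eta>\<^sup>\<star>\<close> and \<open>\<eta>~\<^sup>\<star>\<close> (here \<open>\<eta>s\<close>, \<open>\<eta>ts\<close>).\<close>

definition adjoint_coeff_relation ::
  "depvar jet set \<Rightarrow> nat \<Rightarrow> nat \<Rightarrow> nat \<Rightarrow> (nat \<Rightarrow> depvar jet \<Rightarrow> real) \<Rightarrow>
   (nat \<Rightarrow> nat \<Rightarrow> depvar jet \<Rightarrow> real) \<Rightarrow>
   (nat \<Rightarrow> depvar jet \<Rightarrow> real) \<Rightarrow> (nat \<Rightarrow> depvar jet \<Rightarrow> real) \<Rightarrow> bool" where
  "adjoint_coeff_relation \<Omega> n m mt \<xi> \<Lambda> \<eta>s \<eta>ts \<longleftrightarrow>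
     (\<forall>\<beta><m. \<forall>p\<in>\<Omega>.
        \<eta>s \<beta> p + (\<Sum>\<alpha><mt. \<eta>ts \<alpha> p) =
        - ((\<Sum>\<alpha><m. dep_val (V \<alpha>) p * \<Lambda> \<alpha> \<beta> p)
           + dep_val (V \<beta>) p * total_div n (all_vars m mt) \<xi> p
           + (\<Sum>\<alpha><mt. dep_val (Vt \<alpha>) p) * (\<Sum>\<alpha><m. \<Lambda> \<alpha> \<beta> p)
           + (\<Sum>\<alpha><mt. dep_val (Vt \<alpha>) p) * total_div n (all_vars m mt) \<xi> p))"

end

theory Submission
  imports Defs
begin

text \<open>
  Let \<open>L\<close> be the Lagrangian and write \<open>E\<^sub>z\<close> for the variational derivative with respect to \<open>z\<close>, so
  that \<open>E\<^sub>v L\<close> and \<open>E\<^sub>v\<^sub>~ L\<close> are the \<open>F\<^sub>\<beta>\<close> and their sum, while the adjoint equations are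
  \<open>E\<^sub>u L = 0\<close> and \<open>E\<^sub>u\<^sub>~ L = 0\<close>. The relation imposed on the new coefficients of \<open>Y\<close> makes
  \<open>Pr Y (L) + L Div \<xi>\<close> vanish identically. In terms of the characteristic \<open>W\<close> of \<open>Y\<close> and the
  evolutionary field \<open>pr\<^sub>W = Pr Y - \<Sum>\<^sub>i \<xi>\<^sup>i D\<^sub>i\<close> this says that \<open>pr\<^sub>W L\<close> is the total divergence
  \<open>- Div (\<xi> L)\<close>, so \<open>E\<^sub>z (pr\<^sub>W L) = 0\<close>. On the other hand \<open>E\<^sub>z (pr\<^sub>W L)\<close> equals \<open>pr\<^sub>W (E\<^sub>z L)\<close> plus
  the sum over all \<open>y\<close> of the adjoint Frechet derivatives of \<open>W\<^sup>y\<close> applied to \<open>E\<^sub>y L\<close>. These last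
  terms vanish wherever all \<open>E\<^sub>y L\<close> and their total derivatives do, and there
  \<open>Pr Y (E\<^sub>z L) = pr\<^sub>W (E\<^sub>z L) = 0\<close>.
\<close>

subsection \<open>Smooth functions on jet space\<close>

lemma continuous_on_fun_upd:
  fixes p :: "'a \<Rightarrow> 'b::topological_space"
  shows "continuous_on UNIV (\<lambda>t. p(c := t))"
proof (rule continuous_on_coordinatewise_then_product)
  fix i show "continuous_on UNIV (\<lambda>t. (p(c := t)) i)"
    by (cases "i = c") auto
qed

lemma continuous_on_fun_upd2:
  fixes p :: "'a \<Rightarrow> real"
  shows "continuous_on UNIV (\<lambda>(x, y). p(a := x, b := y))"
proof (rule continuous_on_coordinatewise_then_product)
  fix i show "continuous_on UNIV (\<lambda>z. (case z of (x, y) \<Rightarrow> p(a := x, b := y)) i)"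
    by (cases "i = b"; cases "i = a") (auto simp: case_prod_beta intro!: continuous_intros)
qed

section \<open>Partial derivatives on an open set of jet space\<close>

locale jet_domain =
  fixes \<Omega> :: "'z jet set"
  assumes open_dom: "open \<Omega>"
begin

text \<open>Coordinate lines are continuous in the product topology, so a line through a point of
  the open set stays inside it near that point. Hence partial derivatives depend only on values
  inside \<Omega>, and the congruence rules below rest on this.\<close>

lemma eventually_slice:
  assumes "p \<in> \<Omega>"
  shows "\<forall>\<^sub>F t in nhds (p c). p(c := t) \<in> \<Omega>"
proof -
  have "open ((\<lambda>t. p(c := t)) -` \<Omega>)"
    using open_dom continuous_on_fun_upd by (rule open_vimage)
  then show ?thesis
    using assms by (auto simp: eventually_nhds)
qed

lemma partial_deriv_cong:
  assumes "\<And>q. q \<in> \<Omega> \<Longrightarrow> f q = g q" "p \<in> \<Omega>"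
  shows "partial_deriv c f p = partial_deriv c g p"
  unfolding partial_deriv_def
  by (rule deriv_cong_ev[OF eventually_mono[OF eventually_slice[OF assms(2)]]])
     (use assms in auto)

text \<open>The first clause of \<open>diff_fun_order\<close> for an arbitrary coordinate set, kept
  apart from smoothness because partial derivatives preserve the two for different reasons.\<close>

definition depends_on :: "'z jet_coord set \<Rightarrow> ('z jet \<Rightarrow> real) \<Rightarrow> bool" where
  "depends_on C f \<longleftrightarrow> (\<forall>p\<in>\<Omega>. \<forall>q\<in>\<Omega>. (\<forall>c\<in>C. p c = q c) \<longrightarrow> f p = f q)"

lemma depends_on_mono: "depends_on C f \<Longrightarrow> C \<subseteq> C' \<Longrightarrow> depends_on C' f"
  unfolding depends_on_def by blast

text \<open>Near \<open>p c\<close> the line in direction \<open>c\<close> stays in \<Omega> and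
  leaves all coordinates in \<open>C\<close> alone, so \<open>f\<close> is locally constant along
  it.\<close>

lemma partial_deriv_eq_0:
  assumes "depends_on C f" "c \<notin> C" "p \<in> \<Omega>"
  shows "partial_deriv c f p = 0"
proof -
  have "deriv (\<lambda>t. f (p(c := t))) (p c) = deriv (\<lambda>_. f p) (p c)"
  proof (rule deriv_cong_ev[OF eventually_mono[OF eventually_slice[OF assms(3)]]])
    fix t assume "p(c := t) \<in> \<Omega>"
    moreover have "\<forall>d\<in>C. (p(c := t)) d = p d"
      using assms(2) by auto
    ultimately show "f (p(c := t)) = f p"
      using assms(1,3) unfolding depends_on_def by blast
  qed simp
  then show ?thesis
    by (simp add: partial_deriv_def)
qed

text \<open>If \<open>c\<close> is in \<open>C\<close>, the two points share the value of
  \<open>c\<close>, so both coordinate lines can be run through with the same parameter, and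
  \<open>f\<close> agrees along them near that value. Otherwise both derivatives vanish.\<close>

lemma depends_on_partial_deriv:
  assumes "depends_on C f"
  shows "depends_on C (partial_deriv c f)"
  unfolding depends_on_def
proof safe
  fix p q assume pq: "p \<in> \<Omega>" "q \<in> \<Omega>" "\<forall>d\<in>C. p d = q d"
  show "partial_deriv c f p = partial_deriv c f q"
  proof (cases "c \<in> C")
    case False
    then show ?thesis using partial_deriv_eq_0[OF assms] pq by simp
  next
    case True
    then have c: "p c = q c" using pq by simp
    have ev: "\<forall>\<^sub>F t in nhds (p c). p(c := t) \<in> \<Omega> \<and> q(c := t) \<in> \<Omega>"
      using eventually_conj[OF eventually_slice[OF pq(1)] eventually_slice[OF pq(2), of c, folded c]]
      by simp
    have "deriv (\<lambda>t. f (p(c := t))) (p c) = deriv (\<lambda>t. f (q(c := t))) (p c)"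
    proof (rule deriv_cong_ev[OF eventually_mono[OF ev]])
      fix t assume t: "p(c := t) \<in> \<Omega> \<and> q(c := t) \<in> \<Omega>"
      have "\<forall>d\<in>C. (p(c := t)) d = (q(c := t)) d" using pq(3) by simp
      then show "f (p(c := t)) = f (q(c := t))"
        using assms t unfolding depends_on_def by blast
    qed simp
    then show ?thesis by (simp add: partial_deriv_def c)
  qed
qed

lemma depends_on_foldr: "depends_on C f \<Longrightarrow> depends_on C (foldr partial_deriv cs f)"
  by (induction cs) (auto intro: depends_on_partial_deriv)

section \<open>Smoothness and its closure properties\<close>

definition partially_diff :: "('z jet \<Rightarrow> real) \<Rightarrow> bool" where
  "partially_diff f \<longleftrightarrow> continuous_on \<Omega> f \<and>
     (\<forall>p\<in>\<Omega>. \<forall>c. (\<lambda>t. f (p(c := t))) field_differentiable at (p c))"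

text \<open>The list ranges over all jet coordinates, whereas \<open>diff_fun_order\<close> admits
  only those up to a given order. The unrestricted form has no order to keep track of, and
  \<open>diff_fun_order_iff\<close> reconciles the two.\<close>

definition smooth :: "('z jet \<Rightarrow> real) \<Rightarrow> bool" where
  "smooth f \<longleftrightarrow> (\<forall>cs. partially_diff (foldr partial_deriv cs f))"

lemma partially_diff_cong:
  assumes "\<And>q. q \<in> \<Omega> \<Longrightarrow> f q = g q" "partially_diff f"
  shows "partially_diff g"
  unfolding partially_diff_def
proof (intro conjI ballI allI)
  show "continuous_on \<Omega> g"
    by (rule continuous_on_cong[THEN iffD1, OF refl assms(1)])
       (use assms(2) in \<open>auto simp: partially_diff_def\<close>)
  fix p c assume p: "p \<in> \<Omega>"
  then obtain D where "((\<lambda>t. f (p(c := t))) has_field_derivative D) (at (p c))"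
    using assms(2) unfolding partially_diff_def field_differentiable_def by blast
  moreover have ev: "\<forall>\<^sub>F t in nhds (p c). f (p(c := t)) = g (p(c := t))"
    using eventually_slice[OF p] by (rule eventually_mono) (use assms in auto)
  ultimately have "((\<lambda>t. g (p(c := t))) has_field_derivative D) (at (p c))"
    by (simp add: DERIV_cong_ev[OF refl ev refl])
  then show "(\<lambda>t. g (p(c := t))) field_differentiable at (p c)"
    unfolding field_differentiable_def by blast
qed

lemma partially_diff_deriv:
  assumes "partially_diff f" "p \<in> \<Omega>"
  shows "((\<lambda>t. f (p(c := t))) has_field_derivative partial_deriv c f p) (at (p c))"
  using assms unfolding partially_diff_def partial_deriv_def
  by (simp add: field_differentiable_derivI)

lemma partially_diff_deriv_at:
  assumes "partially_diff f" "p(c := x) \<in> \<Omega>"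
  shows "((\<lambda>t. f (p(c := t))) has_field_derivative partial_deriv c f (p(c := x))) (at x)"
  using partially_diff_deriv[OF assms, of c] by simp

lemma partial_derivI:
  "((\<lambda>t. f (p(c := t))) has_field_derivative D) (at (p c)) \<Longrightarrow> partial_deriv c f p = D"
  unfolding partial_deriv_def by (rule DERIV_imp_deriv)

lemma smooth_imp_partially_diff: "smooth f \<Longrightarrow> partially_diff f"
  unfolding smooth_def by (drule spec[of _ "[]"]) simp

lemma smooth_partial_deriv [intro]: "smooth f \<Longrightarrow> smooth (partial_deriv c f)"
  unfolding smooth_def
proof
  fix cs assume "\<forall>cs. partially_diff (foldr partial_deriv cs f)"
  then have "partially_diff (foldr partial_deriv (cs @ [c]) f)" by blast
  then show "partially_diff (foldr partial_deriv cs (partial_deriv c f))" by simp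
qed

text \<open>Following the class \<open>P\<close> along a list of coordinates, each iterated
  derivative coincides on \<Omega> with a member of \<open>P\<close>. Closure is asked only up to
  equality on \<Omega> because the rules of differentiation are available only there.\<close>

lemma smooth_coinduct:
  assumes "P f" "\<And>f. P f \<Longrightarrow> partially_diff f"
    and "\<And>f c. P f \<Longrightarrow> \<exists>g. P g \<and> (\<forall>q\<in>\<Omega>. partial_deriv c f q = g q)"
  shows "smooth f"
  unfolding smooth_def
proof
  fix cs
  have "\<exists>g. P g \<and> (\<forall>q\<in>\<Omega>. foldr partial_deriv cs f q = g q)"
  proof (induction cs)
    case Nil
    then show ?case using assms(1) by auto
  next
    case (Cons c cs)
    then obtain g where g: "P g" "\<forall>q\<in>\<Omega>. foldr partial_deriv cs f q = g q" by blast
    obtain h where "P h" "\<forall>q\<in>\<Omega>. partial_deriv c g q = h q"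
      using assms(3)[OF g(1)] by blast
    then show ?case
      using g(2) partial_deriv_cong[of "foldr partial_deriv cs f" g] by auto
  qed
  then obtain g where "P g" "\<forall>q\<in>\<Omega>. foldr partial_deriv cs f q = g q" by blast
  then show "partially_diff (foldr partial_deriv cs f)"
    using assms(2)[of g] by - (rule partially_diff_cong[of g], auto)
qed

lemma smooth_cong:
  assumes "\<And>q. q \<in> \<Omega> \<Longrightarrow> f q = g q" "smooth f"
  shows "smooth g"
proof (rule smooth_coinduct[where P = "\<lambda>g. \<exists>f. smooth f \<and> (\<forall>q\<in>\<Omega>. f q = g q)"])
  show "\<exists>f. smooth f \<and> (\<forall>q\<in>\<Omega>. f q = g q)" using assms by auto
next
  fix g assume "\<exists>f. smooth f \<and> (\<forall>q\<in>\<Omega>. f q = g q)"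
  then obtain f where "smooth f" "\<forall>q\<in>\<Omega>. f q = g q" by blast
  then show "partially_diff g"
    using smooth_imp_partially_diff[of f] by - (rule partially_diff_cong[of f], auto)
next
  fix g c assume "\<exists>f. smooth f \<and> (\<forall>q\<in>\<Omega>. f q = g q)"
  then obtain f where f: "smooth f" "\<forall>q\<in>\<Omega>. f q = g q" by blast
  then have "\<forall>q\<in>\<Omega>. partial_deriv c g q = partial_deriv c f q"
    using partial_deriv_cong[of f g] by simp
  then show "\<exists>h. (\<exists>f. smooth f \<and> (\<forall>q\<in>\<Omega>. f q = h q)) \<and> (\<forall>q\<in>\<Omega>. partial_deriv c g q = h q)"
    using smooth_partial_deriv[OF f(1), of c] by blast
qed

text \<open>The derivative of a product is a sum of products, so products of smooth functions alone
  do not form a class suited to \<open>smooth_coinduct\<close>. The generated algebra does.\<close>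

inductive smooth_alg :: "('z jet \<Rightarrow> real) \<Rightarrow> bool" where
  base: "smooth f \<Longrightarrow> smooth_alg f"
| const: "smooth_alg (\<lambda>_. a)"
| coord: "smooth_alg (\<lambda>p. p c)"
| add: "smooth_alg f \<Longrightarrow> smooth_alg g \<Longrightarrow> smooth_alg (\<lambda>p. f p + g p)"
| mult: "smooth_alg f \<Longrightarrow> smooth_alg g \<Longrightarrow> smooth_alg (\<lambda>p. f p * g p)"

lemma partially_diff_const [simp]: "partially_diff (\<lambda>_. a)"
  by (auto simp: partially_diff_def)

lemma partially_diff_coord [simp]: "partially_diff (\<lambda>p. p c)"
  unfolding partially_diff_def
proof (intro conjI ballI allI)
  show "continuous_on \<Omega> (\<lambda>p. p c)"
    by (rule continuous_on_subset[OF continuous_on_product_coordinates]) simp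
  fix p d
  show "(\<lambda>t. (p(d := t)) c) field_differentiable at (p d)"
    by (cases "c = d") auto
qed

lemma partially_diff_add:
  "partially_diff f \<Longrightarrow> partially_diff g \<Longrightarrow> partially_diff (\<lambda>p. f p + g p)"
  unfolding partially_diff_def by (auto intro!: continuous_intros field_differentiable_add)

lemma partially_diff_mult:
  "partially_diff f \<Longrightarrow> partially_diff g \<Longrightarrow> partially_diff (\<lambda>p. f p * g p)"
  unfolding partially_diff_def by (auto intro!: continuous_intros field_differentiable_mult)

lemma partial_deriv_const [simp]: "partial_deriv c (\<lambda>_. a) p = 0"
  by (simp add: partial_deriv_def)

lemma partial_deriv_coord: "partial_deriv c (\<lambda>p. p d) p = (if c = d then 1 else 0)"
  by (rule partial_derivI) (auto simp: fun_upd_def)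

lemma partial_deriv_add':
  assumes "partially_diff f" "partially_diff g" "p \<in> \<Omega>"
  shows "partial_deriv c (\<lambda>p. f p + g p) p = partial_deriv c f p + partial_deriv c g p"
  by (rule partial_derivI DERIV_add partially_diff_deriv assms)+

lemma partial_deriv_mult':
  assumes "partially_diff f" "partially_diff g" "p \<in> \<Omega>"
  shows "partial_deriv c (\<lambda>p. f p * g p) p = partial_deriv c f p * g p + f p * partial_deriv c g p"
proof -
  have "((\<lambda>t. f (p(c := t)) * g (p(c := t))) has_field_derivative
      partial_deriv c f p * g (p(c := p c)) + partial_deriv c g p * f (p(c := p c))) (at (p c))"
    by (rule DERIV_mult partially_diff_deriv assms)+
  then show ?thesis
    by (intro partial_derivI) (simp add: mult.commute)
qed

lemma smooth_alg_partially_diff: "smooth_alg f \<Longrightarrow> partially_diff f"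
  by (induction rule: smooth_alg.induct)
     (auto intro: smooth_imp_partially_diff partially_diff_add partially_diff_mult)

lemma smooth_alg_imp_smooth:
  assumes "smooth_alg f"
  shows "smooth f"
proof (rule smooth_coinduct[of smooth_alg, OF assms smooth_alg_partially_diff])
  fix f c assume "smooth_alg f"
  then show "\<exists>g. smooth_alg g \<and> (\<forall>q\<in>\<Omega>. partial_deriv c f q = g q)"
  proof (induction rule: smooth_alg.induct)
    case (base f)
    then show ?case using smooth_alg.base smooth_partial_deriv by blast
  next
    case (const a)
    then show ?case using smooth_alg.const[of 0] by auto
  next
    case (coord d)
    then show ?case
      using smooth_alg.const[of "if c = d then 1 else 0"] partial_deriv_coord by blast
  next
    case (add f g)
    then obtain f' g' where "smooth_alg f'" "smooth_alg g'"
      "\<forall>q\<in>\<Omega>. partial_deriv c f q = f' q" "\<forall>q\<in>\<Omega>. partial_deriv c g q = g' q" by blast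
    with add.hyps show ?case
      by (intro exI[of _ "\<lambda>q. f' q + g' q"])
         (auto intro: smooth_alg.intros simp: partial_deriv_add' smooth_alg_partially_diff)
  next
    case (mult f g)
    then obtain f' g' where "smooth_alg f'" "smooth_alg g'"
      "\<forall>q\<in>\<Omega>. partial_deriv c f q = f' q" "\<forall>q\<in>\<Omega>. partial_deriv c g q = g' q" by blast
    with mult.hyps show ?case
      by (intro exI[of _ "\<lambda>q. f' q * g q + f q * g' q"])
         (auto intro!: smooth_alg.add smooth_alg.mult simp: partial_deriv_mult' smooth_alg_partially_diff)
  qed
qed

lemma smooth_const [intro]: "smooth (\<lambda>_. a)"
  by (rule smooth_alg_imp_smooth[OF smooth_alg.const])

lemma smooth_coord [intro]: "smooth (\<lambda>p. p c)"
  by (rule smooth_alg_imp_smooth[OF smooth_alg.coord])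

lemma smooth_add [intro]: "smooth f \<Longrightarrow> smooth g \<Longrightarrow> smooth (\<lambda>p. f p + g p)"
  by (rule smooth_alg_imp_smooth[OF smooth_alg.add[OF smooth_alg.base smooth_alg.base]])

lemma smooth_mult [intro]: "smooth f \<Longrightarrow> smooth g \<Longrightarrow> smooth (\<lambda>p. f p * g p)"
  by (rule smooth_alg_imp_smooth[OF smooth_alg.mult[OF smooth_alg.base smooth_alg.base]])

lemma partial_deriv_add:
  assumes "smooth f" "smooth g" "p \<in> \<Omega>"
  shows "partial_deriv c (\<lambda>p. f p + g p) p = partial_deriv c f p + partial_deriv c g p"
  using assms by (intro partial_deriv_add' smooth_imp_partially_diff)

lemma partial_deriv_mult:
  assumes "smooth f" "smooth g" "p \<in> \<Omega>"
  shows "partial_deriv c (\<lambda>p. f p * g p) p = partial_deriv c f p * g p + f p * partial_deriv c g p"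
  using assms by (intro partial_deriv_mult' smooth_imp_partially_diff)

lemma smooth_sum [intro]:
  "(\<And>k. k \<in> A \<Longrightarrow> smooth (f k)) \<Longrightarrow> smooth (\<lambda>p. \<Sum>k\<in>A. f k p)"
  by (induction A rule: infinite_finite_induct) auto

lemma partial_deriv_sum:
  "(\<And>k. k \<in> A \<Longrightarrow> smooth (f k)) \<Longrightarrow> p \<in> \<Omega> \<Longrightarrow>
     partial_deriv c (\<lambda>p. \<Sum>k\<in>A. f k p) p = (\<Sum>k\<in>A. partial_deriv c (f k) p)"
  by (induction A rule: infinite_finite_induct) (auto simp: partial_deriv_add smooth_sum)

text \<open>A derivative in a coordinate outside \<open>jet_coords n Z s\<close> vanishes on
  \<Omega>, so every iterated derivative is, on \<Omega>, either an admissible one or zero.\<close>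

lemma diff_fun_order_iff:
  "diff_fun_order \<Omega> n Z s f \<longleftrightarrow> depends_on (jet_coords n Z s) f \<and> smooth f" (is "?L \<longleftrightarrow> ?R")
proof
  assume ?R
  then show ?L
    unfolding diff_fun_order_def depends_on_def smooth_def partially_diff_def by blast
next
  assume L: ?L
  let ?C = "jet_coords n Z s"
  have dep: "depends_on ?C f"
    using L unfolding diff_fun_order_def depends_on_def by blast
  \<comment> \<open>The class handed to \<open>smooth_coinduct\<close>; the zero function absorbs
    any derivative in a foreign coordinate.\<close>
  let ?P = "\<lambda>g. (\<exists>cs. set cs \<subseteq> ?C \<and> g = foldr partial_deriv cs f) \<or> g = (\<lambda>_. 0)"
  have "smooth f"
  proof (rule smooth_coinduct[where P = ?P])
    show "?P f" by (rule disjI1, rule exI[of _ "[]"]) simp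
  next
    fix g assume "?P g"
    then show "partially_diff g"
    proof
      assume "\<exists>cs. set cs \<subseteq> ?C \<and> g = foldr partial_deriv cs f"
      then obtain cs where cs: "set cs \<subseteq> ?C" "g = foldr partial_deriv cs f" by blast
      show ?thesis
        unfolding partially_diff_def
      proof (intro conjI ballI allI)
        show "continuous_on \<Omega> g"
          using L cs unfolding diff_fun_order_def by blast
        fix p c assume p: "p \<in> \<Omega>"
        show "(\<lambda>t. g (p(c := t))) field_differentiable at (p c)"
        proof (cases "c \<in> ?C")
          case True
          then show ?thesis using L cs p unfolding diff_fun_order_def by blast
        next
          case False
          have dg: "depends_on ?C g" using dep cs depends_on_foldr by blast
          have eq: "g p = g (p(c := t))" if "p(c := t) \<in> \<Omega>" for t
          proof -
            have "\<forall>d\<in>?C. p d = (p(c := t)) d" using False by auto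
            then show ?thesis using dg p that unfolding depends_on_def by blast
          qed
          have ev: "\<forall>\<^sub>F t in nhds (p c). g p = g (p(c := t))"
            using eventually_slice[OF p] by (rule eventually_mono) (rule eq)
          have "((\<lambda>t. g (p(c := t))) has_field_derivative 0) (at (p c))"
            by (rule DERIV_cong_ev[OF refl ev refl, THEN iffD1, OF DERIV_const])
          then show ?thesis unfolding field_differentiable_def by blast
        qed
      qed
    qed simp
  next
    fix g c assume "?P g"
    then show "\<exists>h. ?P h \<and> (\<forall>q\<in>\<Omega>. partial_deriv c g q = h q)"
    proof
      assume "\<exists>cs. set cs \<subseteq> ?C \<and> g = foldr partial_deriv cs f"
      then obtain cs where cs: "set cs \<subseteq> ?C" "g = foldr partial_deriv cs f" by blast
      show ?thesis
      proof (cases "c \<in> ?C")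
        case True
        then show ?thesis
          using cs by (intro exI[of _ "partial_deriv c g"]) (auto intro!: exI[of _ "c # cs"])
      next
        case False
        then show ?thesis
          using partial_deriv_eq_0[OF depends_on_foldr[OF dep]] cs
          by (intro exI[of _ "\<lambda>_. 0"]) auto
      qed
    qed auto
  qed
  then show ?R using dep by blast
qed

text \<open>By the mean value theorem in each direction, the second difference over a square of side
  \<open>h\<close> is \<open>h\<^sup>2\<close> times the mixed derivative at some point of the
  square. Continuity of that derivative gives the limit.\<close>

lemma mixed_difference_quotient:
  assumes f: "smooth f" and p: "p \<in> \<Omega>" and ab: "a \<noteq> b"
  shows "((\<lambda>h. (f (p(a := p a + h, b := p b + h)) - f (p(a := p a + h))
            - f (p(b := p b + h)) + f p) / h\<^sup>2)
          \<longlongrightarrow> partial_deriv b (partial_deriv a f) p) (at_right 0)"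
proof (rule tendstoI)
  fix e :: real assume e: "0 < e"
  let ?K = "partial_deriv b (partial_deriv a f)"
  let ?q = "\<lambda>(x, y). p(a := x, b := y)"
  have pa: "partially_diff f" and pb: "partially_diff (partial_deriv a f)" and pc: "partially_diff ?K"
    using f by (auto intro: smooth_imp_partially_diff)
  have q0: "?q (p a, p b) = p" by simp
  have cq: "continuous_on UNIV ?q" by (rule continuous_on_fun_upd2)
  have "open (?K -` ball (?K p) e \<inter> \<Omega>)"
    using pc continuous_on_open_vimage[OF open_dom, of ?K] unfolding partially_diff_def by blast
  then have "open (\<Omega> \<inter> ?K -` ball (?K p) e)"
    by (simp add: Int_commute)
  then have "open (?q -` (\<Omega> \<inter> ?K -` ball (?K p) e))"
    using cq by (rule open_vimage)
  moreover have "(p a, p b) \<in> ?q -` (\<Omega> \<inter> ?K -` ball (?K p) e)"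
    using p e q0 by simp
  ultimately obtain r where r: "r > 0"
    "\<And>z. dist z (p a, p b) < r \<Longrightarrow> z \<in> ?q -` (\<Omega> \<inter> ?K -` ball (?K p) e)"
    unfolding open_dist by blast
  \<comment> \<open>Staying within \<open>r/2\<close> in each coordinate keeps the Euclidean
    distance in the plane below \<open>r\<close>.\<close>
  have box: "p(a := x, b := y) \<in> \<Omega> \<and> dist (?K (p(a := x, b := y))) (?K p) < e"
    if "\<bar>x - p a\<bar> < r/2" "\<bar>y - p b\<bar> < r/2" for x y
  proof -
    have "dist (x, y) (p a, p b) \<le> \<bar>x - p a\<bar> + \<bar>y - p b\<bar>"
      by (simp add: dist_Pair_Pair dist_real_def sqrt_sum_squares_le_sum_abs)
    also have "\<dots> < r" using that by linarith
    finally have "(x, y) \<in> ?q -` (\<Omega> \<inter> ?K -` ball (?K p) e)" by (rule r(2))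
    then show ?thesis by (simp add: dist_commute)
  qed
  have main: "dist ((f (p(a := p a + h, b := p b + h)) - f (p(a := p a + h))
            - f (p(b := p b + h)) + f p) / h\<^sup>2) (?K p) < e" if h: "0 < h" "h < r/2" for h
  proof -
    \<comment> \<open>The increment of \<open>f\<close> in direction \<open>b\<close> as a function
      of the \<open>a\<close> coordinate; the second difference is the increment of this
      function.\<close>
    let ?phi = "\<lambda>x. f (p(a := x, b := p b + h)) - f (p(a := x, b := p b))"
    have tw: "p(a := x, b := y) = (p(b := y))(a := x)" for x y
      using ab by (rule fun_upd_twist)
    have dphi: "((\<lambda>x. f (p(a := x, b := y))) has_field_derivative
        partial_deriv a f (p(a := x, b := y))) (at x)"
      if "\<bar>x - p a\<bar> < r/2" "\<bar>y - p b\<bar> < r/2" for x y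
      using partially_diff_deriv_at[OF pa, of "p(b := y)" a x] box[OF that]
      unfolding tw by blast
    have "\<exists>z>p a. z < p a + h \<and> ?phi (p a + h) - ?phi (p a) = (p a + h - p a) *
        (partial_deriv a f (p(a := z, b := p b + h)) - partial_deriv a f (p(a := z, b := p b)))"
      by (rule MVT2; (rule DERIV_diff[OF dphi dphi])?) (use h in auto)
    then obtain z where z: "p a < z" "z < p a + h" "?phi (p a + h) - ?phi (p a) = h *
        (partial_deriv a f (p(a := z, b := p b + h)) - partial_deriv a f (p(a := z, b := p b)))"
      by auto
    \<comment> \<open>Preparation for the second mean value theorem, in direction \<open>b\<close>,
      with the \<open>a\<close> coordinate frozen at the intermediate point
      \<open>z\<close>.\<close>
    have dpsi: "((\<lambda>y. partial_deriv a f (p(a := z, b := y))) has_field_derivative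
        ?K (p(a := z, b := y))) (at y)"
      if "\<bar>y - p b\<bar> < r/2" for y
      using partially_diff_deriv_at[OF pb, of "p(a := z)" b y] box[OF _ that, of z] z h by auto
    have "\<exists>w>p b. w < p b + h \<and>
        partial_deriv a f (p(a := z, b := p b + h)) - partial_deriv a f (p(a := z, b := p b)) =
        (p b + h - p b) * ?K (p(a := z, b := w))"
      by (rule MVT2; (rule dpsi)?) (use h in auto)
    then obtain w where w: "p b < w" "w < p b + h"
      "partial_deriv a f (p(a := z, b := p b + h)) - partial_deriv a f (p(a := z, b := p b)) =
        h * ?K (p(a := z, b := w))"
      by auto
    have "p(a := p a + h, b := p b) = p(a := p a + h)" "p(a := p a, b := p b + h) = p(b := p b + h)"
      using ab by (auto simp: fun_eq_iff)
    then have "f (p(a := p a + h, b := p b + h)) - f (p(a := p a + h)) - f (p(b := p b + h)) + f p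
        = ?phi (p a + h) - ?phi (p a)"
      by simp
    also have "\<dots> = h\<^sup>2 * ?K (p(a := z, b := w))"
      using z(3) w(3) by (simp add: power2_eq_square)
    finally show ?thesis
      using box[of z w] z w h by simp
  qed
  show "\<forall>\<^sub>F h in at_right 0. dist ((f (p(a := p a + h, b := p b + h)) - f (p(a := p a + h))
            - f (p(b := p b + h)) + f p) / h\<^sup>2) (?K p) < e"
    using eventually_at_right_real[of 0 "r/2"] r(1) by (auto elim!: eventually_mono intro!: main)
qed

text \<open>The second difference is symmetric in \<open>a\<close> and \<open>b\<close>, so both
  mixed derivatives are limits of the same quotient.\<close>

lemma partial_deriv_commute:
  assumes "smooth f" "p \<in> \<Omega>"
  shows "partial_deriv a (partial_deriv b f) p = partial_deriv b (partial_deriv a f) p"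
proof (cases "a = b")
  case False
  have eq: "f (p(b := p b + h, a := p a + h)) - f (p(b := p b + h)) - f (p(a := p a + h)) + f p
      = f (p(a := p a + h, b := p b + h)) - f (p(a := p a + h)) - f (p(b := p b + h)) + f p" for h
    using fun_upd_twist[OF False, of p] by simp
  show ?thesis
    by (rule tendsto_unique[OF trivial_limit_at_right_real
          mixed_difference_quotient[OF assms False[symmetric], unfolded eq]
          mixed_difference_quotient[OF assms False]])
qed simp

end

subsection \<open>Multi-indices\<close>

abbreviation raise_mi :: "nat \<Rightarrow> (nat \<Rightarrow> nat) \<Rightarrow> nat \<Rightarrow> nat" where
  "raise_mi i J \<equiv> J(i := Suc (J i))"

abbreviation lower_mi :: "nat \<Rightarrow> (nat \<Rightarrow> nat) \<Rightarrow> nat \<Rightarrow> nat" where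
  "lower_mi i J \<equiv> J(i := J i - 1)"

definition mi_upto :: "nat \<Rightarrow> nat \<Rightarrow> (nat \<Rightarrow> nat) set" where
  "mi_upto n N = {J \<in> multi_indices n. mi_size n J \<le> N}"

lemma mi_size_upd: "i < n \<Longrightarrow> mi_size n (J(i := k)) + J i = mi_size n J + k"
  by (simp add: mi_size_def sum.remove[of "{..<n}" i])

lemma mi_size_raise [simp]: "i < n \<Longrightarrow> mi_size n (raise_mi i J) = Suc (mi_size n J)"
  using mi_size_upd[of i n J "Suc (J i)"] by simp

lemma mi_size_lower: "i < n \<Longrightarrow> J i \<noteq> 0 \<Longrightarrow> Suc (mi_size n (lower_mi i J)) = mi_size n J"
  using mi_size_upd[of i n J "J i - 1"] by simp

lemma multi_indices_upd [simp, intro]: "i < n \<Longrightarrow> J \<in> multi_indices n \<Longrightarrow> J(i := k) \<in> multi_indices n"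
  by (auto simp: multi_indices_def)

lemma zero_in_multi_indices [simp, intro]: "(\<lambda>_. 0) \<in> multi_indices n"
  by (simp add: multi_indices_def)

lemma mi_size_zero [simp]: "mi_size n (\<lambda>_. 0) = 0"
  by (simp add: mi_size_def)

text \<open>Lowering a nonzero entry decreases the size, and only the zero index has size 0. Facts
  about \<open>total_deriv_mi\<close> can thus be proved by adding one derivative at a time in an
  arbitrary direction, once total derivatives are known to commute.\<close>

lemma multi_index_induct [consumes 1, case_names zero raise]:
  assumes "J \<in> multi_indices n" "P (\<lambda>_. 0)"
    and "\<And>J i. J \<in> multi_indices n \<Longrightarrow> i < n \<Longrightarrow> P J \<Longrightarrow> P (raise_mi i J)"
  shows "P J"
  using assms(1)
proof (induction "mi_size n J" arbitrary: J)
  case 0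
  then have "J = (\<lambda>_. 0)"
    by (auto simp: mi_size_def multi_indices_def fun_eq_iff) (metis lessThan_iff not_le)
  then show ?case using assms(2) by simp
next
  case (Suc k)
  then obtain i where i: "i < n" "J i \<noteq> 0"
    by (metis mi_size_def lessThan_iff nat.distinct(1) sum.neutral)
  then have "P (lower_mi i J)"
    using Suc mi_size_lower[of i n J] by simp
  then have "P (raise_mi i (lower_mi i J))"
    using Suc.prems i assms(3) by blast
  then show ?case using i by simp
qed

lemma finite_mi_upto [simp]: "finite (mi_upto n N)"
proof (rule finite_subset)
  show "mi_upto n N \<subseteq> {J. \<forall>i. (i \<in> {..<n} \<longrightarrow> J i \<in> {..N}) \<and> (i \<notin> {..<n} \<longrightarrow> J i = 0)}"
  proof (intro subsetI CollectI allI conjI impI)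
    fix J i assume J: "J \<in> mi_upto n N"
    show "J i \<in> {..N}" if "i \<in> {..<n}"
    proof -
      have "J i \<le> mi_size n J" unfolding mi_size_def using that by (intro member_le_sum) auto
      then show ?thesis using J by (simp add: mi_upto_def)
    qed
    show "J i = 0" if "i \<notin> {..<n}"
      using that J by (simp add: mi_upto_def multi_indices_def)
  qed
  show "finite {J. \<forall>i. (i \<in> {..<n} \<longrightarrow> J i \<in> {..N}) \<and> (i \<notin> {..<n} \<longrightarrow> J i = 0)}"
    by (rule finite_set_of_finite_funs) auto
qed

lemma mi_upto_mono: "N \<le> N' \<Longrightarrow> mi_upto n N \<subseteq> mi_upto n N'"
  by (auto simp: mi_upto_def)

lemma mi_uptoD: "J \<in> mi_upto n N \<Longrightarrow> J \<in> multi_indices n"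
  by (simp add: mi_upto_def)

lemma zero_in_mi_upto [simp]: "(\<lambda>_. 0) \<in> mi_upto n N"
  by (simp add: mi_upto_def)

lemma raise_in_mi_upto: "i < n \<Longrightarrow> J \<in> mi_upto n N \<Longrightarrow> raise_mi i J \<in> mi_upto n (Suc N)"
  by (simp add: mi_upto_def)

lemma lower_in_mi_upto: "i < n \<Longrightarrow> J i \<noteq> 0 \<Longrightarrow> J \<in> mi_upto n (Suc N) \<Longrightarrow> lower_mi i J \<in> mi_upto n N"
  using mi_size_lower[of i n J] by (auto simp: mi_upto_def)

text \<open>The index shift behind every integration by parts below: lowering is a bijection with
  inverse \<open>raise_mi i\<close> once the indices with \<open>J i = 0\<close> are excluded. The
  guard is essential, as truncated subtraction leaves those indices unchanged.\<close>

lemma sum_mi_upto_lower: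
  fixes g :: "(nat \<Rightarrow> nat) \<Rightarrow> (nat \<Rightarrow> nat) \<Rightarrow> 'a::comm_monoid_add"
  assumes "i < n"
  shows "(\<Sum>J\<in>mi_upto n (Suc N). if J i = 0 then 0 else g (lower_mi i J) J)
       = (\<Sum>J\<in>mi_upto n N. g J (raise_mi i J))"
proof -
  have "(\<Sum>J\<in>mi_upto n (Suc N). if J i = 0 then 0 else g (lower_mi i J) J)
      = (\<Sum>J\<in>{J \<in> mi_upto n (Suc N). J i \<noteq> 0}. g (lower_mi i J) J)"
    by (rule sum.mono_neutral_cong_right) auto
  also have "\<dots> = (\<Sum>J\<in>mi_upto n N. g J (raise_mi i J))"
    by (rule sum.reindex_bij_witness[where i = "raise_mi i" and j = "lower_mi i"])
       (use assms raise_in_mi_upto lower_in_mi_upto in auto)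
  finally show ?thesis .
qed

lemma sum_mi_upto_mono:
  fixes g :: "(nat \<Rightarrow> nat) \<Rightarrow> 'a::comm_monoid_add"
  assumes "N \<le> N'" "\<And>J. J \<in> multi_indices n \<Longrightarrow> J \<notin> mi_upto n N \<Longrightarrow> g J = 0"
  shows "(\<Sum>J\<in>mi_upto n N'. g J) = (\<Sum>J\<in>mi_upto n N. g J)"
  using assms mi_upto_mono by (intro sum.mono_neutral_right) (auto dest: mi_uptoD)

text \<open>Makes the sums in the definitions finite: a differential function of order
  \<open>N\<close> has no nonzero partial derivative in a jet coordinate whose index lies outside
  \<open>mi_upto n N\<close>.\<close>

lemma infsum_multi_indices:
  fixes g :: "(nat \<Rightarrow> nat) \<Rightarrow> real"
  assumes "\<And>J. J \<in> multi_indices n \<Longrightarrow> J \<notin> mi_upto n N \<Longrightarrow> g J = 0"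
  shows "(\<Sum>\<^sub>\<infinity>J\<in>multi_indices n. g J) = (\<Sum>J\<in>mi_upto n N. g J)"
proof -
  have "infsum g (multi_indices n) = infsum g (mi_upto n N)"
    using assms by (intro infsum_cong_neutral) (auto dest: mi_uptoD)
  then show ?thesis by simp
qed

subsection \<open>Total derivatives\<close>

locale jet_space = jet_domain \<Omega> for \<Omega> :: "'z jet set" +
  fixes n :: nat and Z :: "'z set"
  assumes finite_Z [simp]: "finite Z"
begin

abbreviation "ord \<equiv> diff_fun_order \<Omega> n Z"
abbreviation "df \<equiv> diff_fun \<Omega> n Z"
abbreviation "D \<equiv> total_deriv n Z"
abbreviation "DJ \<equiv> total_deriv_mi n Z"

lemma ord_mono: "ord N f \<Longrightarrow> N \<le> N' \<Longrightarrow> ord N' f"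
  unfolding diff_fun_order_iff by (auto elim!: depends_on_mono simp: jet_coords_def)

lemma ord_smooth: "ord N f \<Longrightarrow> smooth f"
  by (simp add: diff_fun_order_iff)

lemma df_ord: "ord N f \<Longrightarrow> df f"
  by (auto simp: diff_fun_def)

lemma df_smooth: "df f \<Longrightarrow> smooth f"
  by (auto simp: diff_fun_def ord_smooth)

lemma df_obtain_ord:
  assumes "df f"
  obtains N where "N0 \<le> N" "ord N f"
  using assms ord_mono unfolding diff_fun_def by (metis nat_le_linear)

text \<open>A common bound on the orders lets one finite index set serve a whole finite
  family.\<close>

lemma df_common_ord:
  assumes "finite A" "\<And>k. k \<in> A \<Longrightarrow> df (f k)"
  obtains N where "N0 \<le> N" "\<And>k. k \<in> A \<Longrightarrow> ord N (f k)"
proof -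
  have "\<exists>N\<ge>N0. \<forall>k\<in>A. ord N (f k)"
    using assms
  proof (induction A rule: finite_induct)
    case (insert a A)
    then obtain N where N: "N \<ge> N0" "\<forall>k\<in>A. ord N (f k)" by auto
    obtain N' where "N \<le> N'" "ord N' (f a)" using insert.prems df_obtain_ord[of "f a" N] by auto
    then show ?case using N ord_mono by (intro exI[of _ N']) auto
  qed auto
  then show ?thesis using that by blast
qed

lemma ord_cong: "(\<And>q. q \<in> \<Omega> \<Longrightarrow> f q = g q) \<Longrightarrow> ord N f \<Longrightarrow> ord N g"
  unfolding diff_fun_order_iff depends_on_def using smooth_cong by (metis (no_types, lifting))

lemma df_cong: "(\<And>q. q \<in> \<Omega> \<Longrightarrow> f q = g q) \<Longrightarrow> df f \<Longrightarrow> df g"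
  unfolding diff_fun_def using ord_cong by blast

lemma ord_const [intro]: "ord N (\<lambda>_. a)"
  by (auto simp: diff_fun_order_iff depends_on_def)

lemma ord_add [intro]: "ord N f \<Longrightarrow> ord N g \<Longrightarrow> ord N (\<lambda>p. f p + g p)"
  unfolding diff_fun_order_iff depends_on_def using smooth_add by (metis (no_types, lifting))

lemma ord_mult [intro]: "ord N f \<Longrightarrow> ord N g \<Longrightarrow> ord N (\<lambda>p. f p * g p)"
  unfolding diff_fun_order_iff depends_on_def using smooth_mult by (metis (no_types, lifting))

lemma ord_sum [intro]: "(\<And>k. k \<in> A \<Longrightarrow> ord N (f k)) \<Longrightarrow> ord N (\<lambda>p. \<Sum>k\<in>A. f k p)"
  by (induction A rule: infinite_finite_induct) auto

lemma ord_partial_deriv [intro]: "ord N f \<Longrightarrow> ord N (partial_deriv c f)"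
  by (auto simp: diff_fun_order_iff intro: depends_on_partial_deriv)

lemma ord_jet [intro]: "z \<in> Z \<Longrightarrow> J \<in> mi_upto n N \<Longrightarrow> ord N (\<lambda>p. p (Jet z J))"
  by (auto simp: diff_fun_order_iff depends_on_def jet_coords_def mi_upto_def)

lemma df_const [intro]: "df (\<lambda>_. a)"
  using df_ord by blast

lemma df_add [intro]: "df f \<Longrightarrow> df g \<Longrightarrow> df (\<lambda>p. f p + g p)"
  by (metis df_obtain_ord ord_mono df_ord ord_add)

lemma df_mult [intro]: "df f \<Longrightarrow> df g \<Longrightarrow> df (\<lambda>p. f p * g p)"
  by (metis df_obtain_ord ord_mono df_ord ord_mult)

lemma df_minus [intro]: "df f \<Longrightarrow> df (\<lambda>p. - f p)"
  using df_mult[OF df_const[of "- 1"]] by simp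

lemma df_diff [intro]: "df f \<Longrightarrow> df g \<Longrightarrow> df (\<lambda>p. f p - g p)"
  using df_add[OF _ df_minus] by simp

lemma df_sum [intro]: "(\<And>k. k \<in> A \<Longrightarrow> df (f k)) \<Longrightarrow> df (\<lambda>p. \<Sum>k\<in>A. f k p)"
  by (induction A rule: infinite_finite_induct) auto

lemma df_partial_deriv [intro]: "df f \<Longrightarrow> df (partial_deriv c f)"
  unfolding diff_fun_def by blast

lemma df_jet [intro]: "z \<in> Z \<Longrightarrow> J \<in> multi_indices n \<Longrightarrow> df (\<lambda>p. p (Jet z J))"
  using ord_jet[of z J "mi_size n J"] df_ord by (auto simp: mi_upto_def)

lemma partial_deriv_jet_eq_0:
  assumes "ord N f" "J \<notin> mi_upto n N" "p \<in> \<Omega>"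
  shows "partial_deriv (Jet z J) f p = 0"
  using assms by (intro partial_deriv_eq_0[of "jet_coords n Z N"])
    (auto simp: diff_fun_order_iff jet_coords_def mi_upto_def)

lemma total_deriv_eq:
  assumes "ord N f" "p \<in> \<Omega>"
  shows "D i f p = partial_deriv (Indep i) f p +
    (\<Sum>z\<in>Z. \<Sum>J\<in>mi_upto n N. p (Jet z (raise_mi i J)) * partial_deriv (Jet z J) f p)"
  unfolding total_deriv_def
  using assms by (subst infsum_multi_indices[of n N]) (auto simp: partial_deriv_jet_eq_0)

lemma total_deriv_cong:
  assumes "\<And>q. q \<in> \<Omega> \<Longrightarrow> f q = g q" "p \<in> \<Omega>"
  shows "D i f p = D i g p"
proof -
  have "partial_deriv c f p = partial_deriv c g p" for c
    using assms by (rule partial_deriv_cong)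
  then show ?thesis by (simp add: total_deriv_def)
qed

lemma ord_total_deriv:
  assumes "ord N f" "i < n"
  shows "ord (Suc N) (D i f)"
proof (rule ord_cong[OF total_deriv_eq[OF assms(1), symmetric]])
  have "ord (Suc N) f" using assms(1) by (rule ord_mono) simp
  then show "ord (Suc N) (\<lambda>p. partial_deriv (Indep i) f p +
    (\<Sum>z\<in>Z. \<Sum>J\<in>mi_upto n N. p (Jet z (raise_mi i J)) * partial_deriv (Jet z J) f p))"
    using assms(2)
    by (intro ord_add ord_sum ord_mult ord_partial_deriv ord_jet raise_in_mi_upto)
qed

lemma df_total_deriv [intro]: "df f \<Longrightarrow> i < n \<Longrightarrow> df (D i f)"
  using ord_total_deriv unfolding diff_fun_def by blast

lemma total_deriv_const [simp]: "D i (\<lambda>_. a) p = 0"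
  by (simp add: total_deriv_def)

lemma total_deriv_add:
  assumes "df f" "df g" "p \<in> \<Omega>"
  shows "D i (\<lambda>p. f p + g p) p = D i f p + D i g p"
proof -
  obtain N where N: "ord N f" "ord N g"
    using assms by (metis df_obtain_ord ord_mono)
  have "ord N (\<lambda>p. f p + g p)" using N by blast
  from total_deriv_eq[OF this assms(3), of i] show ?thesis
    using assms(3) N ord_smooth
    by (simp add: total_deriv_eq[OF N(1)] total_deriv_eq[OF N(2)] partial_deriv_add
        distrib_left sum.distrib)
qed

lemma total_deriv_mult:
  assumes "df f" "df g" "p \<in> \<Omega>"
  shows "D i (\<lambda>p. f p * g p) p = D i f p * g p + f p * D i g p"
proof -
  obtain N where N: "ord N f" "ord N g"
    using assms by (metis df_obtain_ord ord_mono)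
  have "ord N (\<lambda>p. f p * g p)" using N by blast
  from total_deriv_eq[OF this assms(3), of i] show ?thesis
    using assms(3) N ord_smooth
    by (simp add: total_deriv_eq[OF N(1)] total_deriv_eq[OF N(2)] partial_deriv_mult
        algebra_simps sum.distrib sum_distrib_left)
qed

lemma total_deriv_sum:
  "(\<And>k. k \<in> A \<Longrightarrow> df (f k)) \<Longrightarrow> p \<in> \<Omega> \<Longrightarrow> D i (\<lambda>p. \<Sum>k\<in>A. f k p) p = (\<Sum>k\<in>A. D i (f k) p)"
  by (induction A rule: infinite_finite_induct) (auto simp: total_deriv_add df_sum)

lemma total_deriv_jet:
  assumes "z \<in> Z" "J \<in> multi_indices n" "p \<in> \<Omega>"
  shows "D i (\<lambda>p. p (Jet z J)) p = p (Jet z (raise_mi i J))"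
proof -
  let ?N = "mi_size n J"
  have J: "J \<in> mi_upto n ?N" using assms by (simp add: mi_upto_def)
  have "D i (\<lambda>p. p (Jet z J)) p = (\<Sum>z'\<in>Z. \<Sum>J'\<in>mi_upto n ?N.
      if z' = z then if J' = J then p (Jet z (raise_mi i J)) else 0 else 0)"
    using total_deriv_eq[OF ord_jet[OF assms(1) J] assms(3)]
    by (auto simp: partial_deriv_coord intro!: sum.cong)
  also have "\<dots> = (\<Sum>z'\<in>Z. if z' = z then p (Jet z (raise_mi i J)) else 0)"
    using J by (intro sum.cong refl) (simp add: sum.delta)
  finally show ?thesis using assms(1) by (simp add: sum.delta)
qed

text \<open>Product rule on the expansion of \<open>D i f\<close>. Where \<open>f\<close> is
  differentiated twice, symmetry of mixed partials recombines the terms to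
  \<open>D i (partial_deriv c f)\<close>; where a coefficient is differentiated, only the
  coefficient equal to the coordinate \<open>c\<close> contributes.\<close>

lemma partial_deriv_total_deriv_expand:
  assumes f: "ord N f" and i: "i < n" and p: "p \<in> \<Omega>"
  shows "partial_deriv c (D i f) p = D i (partial_deriv c f) p +
    (\<Sum>z\<in>Z. \<Sum>J\<in>mi_upto n N.
       (if c = Jet z (raise_mi i J) then 1 else 0) * partial_deriv (Jet z J) f p)"
proof -
  have sf: "smooth f" using f by (rule ord_smooth)
  have "partial_deriv c (D i f) p = partial_deriv c (\<lambda>p. partial_deriv (Indep i) f p +
    (\<Sum>z\<in>Z. \<Sum>J\<in>mi_upto n N. p (Jet z (raise_mi i J)) * partial_deriv (Jet z J) f p)) p"
    by (rule partial_deriv_cong[OF total_deriv_eq[OF f] p])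
  also have "\<dots> = partial_deriv c (partial_deriv (Indep i) f) p +
    (\<Sum>z\<in>Z. \<Sum>J\<in>mi_upto n N.
       (if c = Jet z (raise_mi i J) then 1 else 0) * partial_deriv (Jet z J) f p +
       p (Jet z (raise_mi i J)) * partial_deriv c (partial_deriv (Jet z J) f) p)"
    using sf p by (simp add: partial_deriv_add partial_deriv_sum partial_deriv_mult
        partial_deriv_coord smooth_sum smooth_mult smooth_coord smooth_partial_deriv)
  also have "\<dots> = partial_deriv (Indep i) (partial_deriv c f) p +
    (\<Sum>z\<in>Z. \<Sum>J\<in>mi_upto n N.
       p (Jet z (raise_mi i J)) * partial_deriv (Jet z J) (partial_deriv c f) p) +
    (\<Sum>z\<in>Z. \<Sum>J\<in>mi_upto n N.
       (if c = Jet z (raise_mi i J) then 1 else 0) * partial_deriv (Jet z J) f p)"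
    using partial_deriv_commute[OF sf p, of c] by (simp add: sum.distrib)
  finally show ?thesis
    using total_deriv_eq[OF ord_partial_deriv[OF f] p, of i c] by simp
qed

lemma partial_deriv_Indep_total_deriv:
  assumes "df f" "i < n" "p \<in> \<Omega>"
  shows "partial_deriv (Indep j) (D i f) p = D i (partial_deriv (Indep j) f) p"
  using assms partial_deriv_total_deriv_expand[of _ f i p "Indep j"]
  unfolding diff_fun_def by auto

text \<open>The basic commutator [d/dz_J, D_i] = d/dz_(J - e_i). The coordinate z_J occurs as a
  coefficient in the expansion of \<open>D i f\<close> only at the lowered index, and not at all if
  \<open>J i = 0\<close>.\<close>

lemma partial_deriv_Jet_total_deriv:
  assumes f: "df f" and i: "i < n" and p: "p \<in> \<Omega>" and z: "z \<in> Z" and J: "J \<in> multi_indices n"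
  shows "partial_deriv (Jet z J) (D i f) p = D i (partial_deriv (Jet z J) f) p +
    (if J i = 0 then 0 else partial_deriv (Jet z (lower_mi i J)) f p)"
proof -
  \<comment> \<open>The cutoff is at least the size of \<open>J\<close>, so that the lowered index
    falls within the finite sum.\<close>
  obtain N where N: "mi_size n J \<le> N" "ord N f" using df_obtain_ord[OF f] by blast
  have "(\<Sum>z'\<in>Z. \<Sum>K\<in>mi_upto n N.
       (if Jet z J = Jet z' (raise_mi i K) then 1 else 0) * partial_deriv (Jet z' K) f p) =
     (if J i = 0 then 0 else partial_deriv (Jet z (lower_mi i J)) f p)"
  proof (cases "J i = 0")
    case True
    then have "J \<noteq> raise_mi i K" for K by (metis fun_upd_same nat.distinct(1))
    then show ?thesis using True by simp
  next
    case False
    then have eq: "J = raise_mi i K \<longleftrightarrow> K = lower_mi i J" for K by auto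
    have "lower_mi i J \<in> mi_upto n N"
      using N(1) J i mi_size_lower[OF i, of J] False by (simp add: mi_upto_def)
    then have "(\<Sum>z'\<in>Z. \<Sum>K\<in>mi_upto n N.
       (if Jet z J = Jet z' (raise_mi i K) then 1 else 0) * partial_deriv (Jet z' K) f p) =
       (\<Sum>z'\<in>Z. if z' = z then partial_deriv (Jet z (lower_mi i J)) f p else 0)"
      by (intro sum.cong refl) (auto simp: eq if_distrib[of "\<lambda>x. x * _"] sum.delta cong: if_cong)
    then show ?thesis using False z by (simp add: sum.delta)
  qed
  then show ?thesis using partial_deriv_total_deriv_expand[OF N(2) i p, of "Jet z J"] by simp
qed

text \<open>Expanding the outer derivative on each side, the commutator terms of \<open>D j\<close>,
  after an index shift, are exactly what the product rule yields when \<open>D j\<close> hits the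
  coefficients of \<open>D i f\<close>.\<close>

lemma total_deriv_commute:
  assumes f: "df f" and i: "i < n" and j: "j < n" and p: "p \<in> \<Omega>"
  shows "D i (D j f) p = D j (D i f) p"
proof (cases "i = j")
  case False
  obtain N where N: "ord N f" using f unfolding diff_fun_def by blast
  have tw: "raise_mi i (raise_mi j J) = raise_mi j (raise_mi i J)" for J
    using False by (simp add: fun_upd_twist)
  have "D i (D j f) p = partial_deriv (Indep i) (D j f) p + (\<Sum>z\<in>Z. \<Sum>J\<in>mi_upto n (Suc N).
      p (Jet z (raise_mi i J)) * partial_deriv (Jet z J) (D j f) p)"
    by (rule total_deriv_eq[OF ord_total_deriv[OF N j] p])
  also have "\<dots> = D j (partial_deriv (Indep i) f) p +
     (\<Sum>z\<in>Z. (\<Sum>J\<in>mi_upto n (Suc N). p (Jet z (raise_mi i J)) * D j (partial_deriv (Jet z J) f) p)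
       + (\<Sum>J\<in>mi_upto n (Suc N). if J j = 0 then 0 else
            p (Jet z (raise_mi i J)) * partial_deriv (Jet z (lower_mi j J)) f p))"
    unfolding sum.distrib[symmetric]
    by (intro arg_cong2[where f = "(+)"] sum.cong refl)
       (auto simp: partial_deriv_Indep_total_deriv partial_deriv_Jet_total_deriv f j p
         distrib_left dest: mi_uptoD)
  also have "\<dots> = D j (partial_deriv (Indep i) f) p +
     (\<Sum>z\<in>Z. (\<Sum>J\<in>mi_upto n N. p (Jet z (raise_mi i J)) * D j (partial_deriv (Jet z J) f) p)
       + (\<Sum>J\<in>mi_upto n N. p (Jet z (raise_mi i (raise_mi j J))) * partial_deriv (Jet z J) f p))"
  proof (rule arg_cong2[where f = "(+)", OF refl sum.cong[OF refl]],
      rule arg_cong2[where f = "(+)"])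
    fix z
    show "(\<Sum>J\<in>mi_upto n (Suc N). p (Jet z (raise_mi i J)) * D j (partial_deriv (Jet z J) f) p) =
          (\<Sum>J\<in>mi_upto n N. p (Jet z (raise_mi i J)) * D j (partial_deriv (Jet z J) f) p)"
    proof (rule sum_mi_upto_mono)
      fix J assume "J \<notin> mi_upto n N"
      then have "D j (partial_deriv (Jet z J) f) p = D j (\<lambda>_. 0) p"
        using N p by (intro total_deriv_cong) (auto simp: partial_deriv_jet_eq_0)
      then show "p (Jet z (raise_mi i J)) * D j (partial_deriv (Jet z J) f) p = 0" by simp
    qed simp
    show "(\<Sum>J\<in>mi_upto n (Suc N). if J j = 0 then 0 else
            p (Jet z (raise_mi i J)) * partial_deriv (Jet z (lower_mi j J)) f p) =
       (\<Sum>J\<in>mi_upto n N. p (Jet z (raise_mi i (raise_mi j J))) * partial_deriv (Jet z J) f p)"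
      by (rule sum_mi_upto_lower[OF j])
  qed
  also have "\<dots> = D j (\<lambda>p. partial_deriv (Indep i) f p +
    (\<Sum>z\<in>Z. \<Sum>J\<in>mi_upto n N. p (Jet z (raise_mi i J)) * partial_deriv (Jet z J) f p)) p"
    using f i p by (simp add: total_deriv_add total_deriv_sum total_deriv_mult total_deriv_jet
        df_sum df_mult df_jet df_partial_deriv mi_uptoD sum.distrib tw add.commute
        del: fun_upd_apply)
  also have "\<dots> = D j (D i f) p"
    by (rule total_deriv_cong[OF total_deriv_eq[OF N, symmetric] p])
  finally show ?thesis .
qed simp

section \<open>Total derivatives along a multi-index\<close>

declare fun_upd_apply [simp del] fun_upd_same [simp] fun_upd_other [simp]

lemma df_funpow: "df f \<Longrightarrow> i < n \<Longrightarrow> df ((D i ^^ k) f)"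
  by (induction k) auto

lemma funpow_total_deriv_cong:
  assumes "\<And>q. q \<in> \<Omega> \<Longrightarrow> f q = g q" "p \<in> \<Omega>"
  shows "(D i ^^ k) f p = (D i ^^ k) g p"
  using assms(2) by (induction k arbitrary: p) (auto intro: assms(1) total_deriv_cong)

lemma funpow_total_deriv_commute:
  assumes "df f" "i < n" "j < n" "p \<in> \<Omega>"
  shows "(D j ^^ k) (D i f) p = D i ((D j ^^ k) f) p"
  using assms(4)
proof (induction k arbitrary: p)
  case (Suc k)
  have "(D j ^^ Suc k) (D i f) p = D j (D i ((D j ^^ k) f)) p"
    using Suc by (auto intro: total_deriv_cong)
  then show ?case
    using total_deriv_commute[OF df_funpow[OF assms(1,3)] assms(3,2) Suc.prems] by simp
qed simp

lemma df_foldr_total_deriv: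
  "df f \<Longrightarrow> set is \<subseteq> {..<n} \<Longrightarrow> df (foldr (\<lambda>i. D i ^^ J i) is f)"
  by (induction "is") (auto intro: df_funpow)

lemma foldr_total_deriv_cong:
  assumes "\<And>q. q \<in> \<Omega> \<Longrightarrow> f q = g q" "p \<in> \<Omega>"
  shows "foldr (\<lambda>i. D i ^^ J i) is f p = foldr (\<lambda>i. D i ^^ J i) is g p"
  using assms(2) by (induction "is" arbitrary: p) (auto intro: assms(1) funpow_total_deriv_cong)

lemma foldr_total_deriv_commute:
  assumes "df f" "i < n" "set is \<subseteq> {..<n}" "p \<in> \<Omega>"
  shows "foldr (\<lambda>i. D i ^^ J i) is (D i f) p = D i (foldr (\<lambda>i. D i ^^ J i) is f) p"
  using assms(3,4)
proof (induction "is" arbitrary: p)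
  case (Cons j js)
  let ?g = "foldr (\<lambda>i. D i ^^ J i) js"
  have "(D j ^^ J j) (?g (D i f)) p = (D j ^^ J j) (D i (?g f)) p"
    using Cons by (intro funpow_total_deriv_cong) auto
  then show ?case
    using funpow_total_deriv_commute[OF df_foldr_total_deriv[OF assms(1)] assms(2)] Cons.prems
    by simp
qed simp

text \<open>The additional \<open>D i\<close> stands at the head of the block of \<open>i\<close>
  and has to be moved to the front through the blocks before it by commutation. Distinctness ensures
  that the later blocks are unaffected by the raised entry.\<close>

lemma foldr_total_deriv_raise:
  assumes "df f" "i < n" "set is \<subseteq> {..<n}" "distinct is" "i \<in> set is" "p \<in> \<Omega>"
  shows "foldr (\<lambda>j. D j ^^ raise_mi i J j) is f p = D i (foldr (\<lambda>j. D j ^^ J j) is f) p"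
  using assms(3-6)
proof (induction "is" arbitrary: p)
  case (Cons j js)
  let ?g = "foldr (\<lambda>j. D j ^^ J j) js"
  let ?g' = "foldr (\<lambda>j. D j ^^ raise_mi i J j) js"
  show ?case
  proof (cases "i = j")
    case True
    then have "?g' f = ?g f"
      using Cons.prems by (intro foldr_cong) (auto simp: fun_upd_apply)
    then show ?thesis using True by simp
  next
    case False
    then have "(D j ^^ J j) (?g' f) p = (D j ^^ J j) (D i (?g f)) p"
      using Cons by (intro funpow_total_deriv_cong) auto
    then show ?thesis
      using funpow_total_deriv_commute[OF df_foldr_total_deriv[OF assms(1)] assms(2)] Cons.prems False
      by simp
  qed
qed simp

lemma df_total_deriv_mi [intro]: "df f \<Longrightarrow> df (DJ J f)"
  unfolding total_deriv_mi_def by (rule df_foldr_total_deriv) auto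

lemma total_deriv_mi_cong:
  assumes "\<And>q. q \<in> \<Omega> \<Longrightarrow> f q = g q" "p \<in> \<Omega>"
  shows "DJ J f p = DJ J g p"
  unfolding total_deriv_mi_def using assms by (rule foldr_total_deriv_cong)

lemma total_deriv_mi_zero [simp]: "DJ (\<lambda>_. 0) f = f"
proof -
  have "foldr (\<lambda>i. D i ^^ 0) is f = f" for "is" by (induction "is") auto
  then show ?thesis by (simp add: total_deriv_mi_def)
qed

lemma total_deriv_mi_raise: "df f \<Longrightarrow> i < n \<Longrightarrow> p \<in> \<Omega> \<Longrightarrow> DJ (raise_mi i J) f p = D i (DJ J f) p"
  unfolding total_deriv_mi_def by (rule foldr_total_deriv_raise) auto

lemma total_deriv_mi_total_deriv: "df f \<Longrightarrow> i < n \<Longrightarrow> p \<in> \<Omega> \<Longrightarrow> DJ J (D i f) p = D i (DJ J f) p"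
  unfolding total_deriv_mi_def by (rule foldr_total_deriv_commute) auto

lemma total_deriv_mi_raise': "df f \<Longrightarrow> i < n \<Longrightarrow> p \<in> \<Omega> \<Longrightarrow> DJ (raise_mi i J) f p = DJ J (D i f) p"
  by (simp add: total_deriv_mi_raise total_deriv_mi_total_deriv)

lemma total_deriv_mi_const_0 [simp]: 
  assumes "J \<in> multi_indices n" "p \<in> \<Omega>"
  shows "DJ J (\<lambda>_. 0) p = 0"
  using assms
proof (induction J arbitrary: p rule: multi_index_induct)
  case (raise J i)
  then have "D i (DJ J (\<lambda>_. 0)) p = D i (\<lambda>_. 0) p"
    by (intro total_deriv_cong) auto
  then show ?case using raise by (simp add: total_deriv_mi_raise df_const)
qed simp

lemma total_deriv_mi_add:
  assumes "J \<in> multi_indices n" "df f" "df g" "p \<in> \<Omega>"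
  shows "DJ J (\<lambda>p. f p + g p) p = DJ J f p + DJ J g p"
  using assms(1,4)
proof (induction J arbitrary: p rule: multi_index_induct)
  case (raise J i)
  then have "D i (DJ J (\<lambda>p. f p + g p)) p = D i (\<lambda>p. DJ J f p + DJ J g p) p"
    by (intro total_deriv_cong) auto
  then show ?case using raise assms(2,3)
    by (simp add: total_deriv_mi_raise total_deriv_add df_add df_total_deriv_mi)
qed simp

lemma total_deriv_mi_sum:
  "J \<in> multi_indices n \<Longrightarrow> (\<And>k. k \<in> A \<Longrightarrow> df (f k)) \<Longrightarrow> p \<in> \<Omega> \<Longrightarrow>
     DJ J (\<lambda>p. \<Sum>k\<in>A. f k p) p = (\<Sum>k\<in>A. DJ J (f k) p)"
  by (induction A rule: infinite_finite_induct) (auto simp: total_deriv_mi_add df_sum)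

lemma total_deriv_mi_cmult:
  assumes "J \<in> multi_indices n" "df f" "p \<in> \<Omega>"
  shows "DJ J (\<lambda>p. a * f p) p = a * DJ J f p"
  using assms(1,3)
proof (induction J arbitrary: p rule: multi_index_induct)
  case (raise J i)
  then have "D i (DJ J (\<lambda>p. a * f p)) p = D i (\<lambda>p. a * DJ J f p) p"
    by (intro total_deriv_cong) auto
  then show ?case using raise assms(2)
    by (simp add: total_deriv_mi_raise total_deriv_mult df_mult df_const df_total_deriv_mi)
qed simp

text \<open>The Leibniz rule expresses the left side through total derivatives of \<open>g\<close>
  at \<open>p\<close>. Its explicit form is avoided by generalizing the induction over
  \<open>f\<close> and \<open>g\<close>: one derivative produces two products, and
  \<open>D i g\<close> inherits the vanishing at \<open>p\<close>.\<close>

lemma total_deriv_mi_mult_eq_0: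
  assumes "J \<in> multi_indices n" "df f" "df g" "p \<in> \<Omega>"
    and "\<And>K. K \<in> multi_indices n \<Longrightarrow> DJ K g p = 0"
  shows "DJ J (\<lambda>q. f q * g q) p = 0"
  using assms
proof (induction J arbitrary: f g rule: multi_index_induct)
  case zero
  then show ?case using zero(4)[of "\<lambda>_. 0"] by simp
next
  case (raise J i)
  note df = raise.prems(1,2) and p = raise.prems(3) and vanish = raise.prems(4)
  have "DJ (raise_mi i J) (\<lambda>q. f q * g q) p = DJ J (\<lambda>q. D i f q * g q + f q * D i g q) p"
    using raise.hyps df p
    by (auto simp: total_deriv_mi_raise' df_mult total_deriv_mult intro!: total_deriv_mi_cong)
  also have "\<dots> = DJ J (\<lambda>q. D i f q * g q) p + DJ J (\<lambda>q. f q * D i g q) p"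
    using raise.hyps df p by (intro total_deriv_mi_add) auto
  also have "DJ J (\<lambda>q. D i f q * g q) p = 0"
    using raise.hyps df p vanish by (intro raise.IH) auto
  also have "DJ J (\<lambda>q. f q * D i g q) p = 0"
  proof (rule raise.IH)
    fix K assume "K \<in> multi_indices n"
    then show "DJ K (D i g) p = 0"
      using vanish[of "raise_mi i K"] raise.hyps df p by (simp add: total_deriv_mi_raise')
  qed (use raise.hyps df p in auto)
  finally show ?case by simp
qed

subsection \<open>Variational derivatives and integration by parts\<close>

text \<open>
  The adjoint of the Frechet derivative of \<open>f\<close> in the direction \<open>z\<close>, applied to \<open>g\<close>. For
  \<open>g = 1\<close> and \<open>N\<close> at least the order of \<open>f\<close> it is the variational derivative of \<open>f\<close>.
\<close>
definition euler_pairing :: "nat \<Rightarrow> 'z \<Rightarrow> ('z jet \<Rightarrow> real) \<Rightarrow> ('z jet \<Rightarrow> real) \<Rightarrow> 'z jet \<Rightarrow> real" where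
  "euler_pairing N z f g p =
     (\<Sum>J\<in>mi_upto n N. (-1) ^ mi_size n J * DJ J (\<lambda>q. partial_deriv (Jet z J) f q * g q) p)"

abbreviation "euler \<equiv> variational_deriv n Z"

lemma df_euler_pairing [intro]: "df f \<Longrightarrow> df g \<Longrightarrow> df (euler_pairing N z f g)"
  unfolding euler_pairing_def[abs_def]
  by (intro df_sum df_mult df_const df_total_deriv_mi df_partial_deriv)

lemma total_deriv_mi_jet_eq_0:
  assumes "ord N f" "J \<in> multi_indices n" "J \<notin> mi_upto n N" "p \<in> \<Omega>"
  shows "DJ J (\<lambda>q. partial_deriv (Jet z J) f q * g q) p = 0"
proof -
  have "DJ J (\<lambda>q. partial_deriv (Jet z J) f q * g q) p = DJ J (\<lambda>_. 0) p"
    using assms by (intro total_deriv_mi_cong) (auto simp: partial_deriv_jet_eq_0)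
  then show ?thesis using assms by simp
qed

text \<open>The added terms contain partial derivatives of \<open>f\<close> beyond its order.
  Pairings of functions of different orders can thus be brought to one cutoff.\<close>

lemma euler_pairing_mono:
  assumes "ord N f" "N \<le> N'" "p \<in> \<Omega>"
  shows "euler_pairing N' z f g p = euler_pairing N z f g p"
  unfolding euler_pairing_def
  using assms by (intro sum_mi_upto_mono) (auto simp: total_deriv_mi_jet_eq_0)

lemma euler_eq:
  assumes "ord N f" "p \<in> \<Omega>"
  shows "euler z f p = euler_pairing N z f (\<lambda>_. 1) p"
  unfolding variational_deriv_def euler_pairing_def
  using total_deriv_mi_jet_eq_0[OF assms(1) _ _ assms(2), of _ z "\<lambda>_. 1"]
  by (subst infsum_multi_indices[of n N]) auto

lemma df_euler [intro]: "df f \<Longrightarrow> df (euler z f)"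
  by (metis df_obtain_ord df_cong euler_eq df_euler_pairing df_const)

lemma euler_pairing_cong:
  assumes "\<And>q. q \<in> \<Omega> \<Longrightarrow> f q = f' q" "\<And>q. q \<in> \<Omega> \<Longrightarrow> g q = g' q" "p \<in> \<Omega>"
  shows "euler_pairing N z f g p = euler_pairing N z f' g' p"
  unfolding euler_pairing_def
  using assms
  by (intro sum.cong refl arg_cong2[where f = "(*)"] total_deriv_mi_cong)
     (auto simp: partial_deriv_cong[of f f'])

lemma euler_pairing_sum_right:
  assumes "df f" "\<And>k. k \<in> A \<Longrightarrow> df (g k)" "p \<in> \<Omega>"
  shows "euler_pairing N z f (\<lambda>p. \<Sum>k\<in>A. g k p) p = (\<Sum>k\<in>A. euler_pairing N z f (g k) p)"
proof -
  have "euler_pairing N z f (\<lambda>p. \<Sum>k\<in>A. g k p) p =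
    (\<Sum>J\<in>mi_upto n N. \<Sum>k\<in>A. (-1) ^ mi_size n J * DJ J (\<lambda>q. partial_deriv (Jet z J) f q * g k q) p)"
    unfolding euler_pairing_def sum_distrib_left
    using assms by (intro sum.cong refl)
      (auto simp: total_deriv_mi_sum df_mult df_partial_deriv sum_distrib_left dest!: mi_uptoD)
  then show ?thesis unfolding euler_pairing_def by (subst sum.swap) simp
qed

lemma euler_pairing_sum_left:
  assumes "\<And>k. k \<in> A \<Longrightarrow> df (f k)" "df g" "p \<in> \<Omega>"
  shows "euler_pairing N z (\<lambda>p. \<Sum>k\<in>A. f k p) g p = (\<Sum>k\<in>A. euler_pairing N z (f k) g p)"
proof -
  have "DJ J (\<lambda>q. partial_deriv (Jet z J) (\<lambda>p. \<Sum>k\<in>A. f k p) q * g q) p =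
        (\<Sum>k\<in>A. DJ J (\<lambda>q. partial_deriv (Jet z J) (f k) q * g q) p)" if "J \<in> multi_indices n" for J
  proof -
    have "DJ J (\<lambda>q. partial_deriv (Jet z J) (\<lambda>p. \<Sum>k\<in>A. f k p) q * g q) p =
          DJ J (\<lambda>q. \<Sum>k\<in>A. partial_deriv (Jet z J) (f k) q * g q) p"
      using assms by (intro total_deriv_mi_cong)
        (auto simp: partial_deriv_sum df_smooth sum_distrib_right)
    then show ?thesis
      using assms that by (simp add: total_deriv_mi_sum df_mult df_partial_deriv)
  qed
  then have "euler_pairing N z (\<lambda>p. \<Sum>k\<in>A. f k p) g p =
    (\<Sum>J\<in>mi_upto n N. \<Sum>k\<in>A. (-1) ^ mi_size n J * DJ J (\<lambda>q. partial_deriv (Jet z J) (f k) q * g q) p)"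
    unfolding euler_pairing_def by (simp add: mi_uptoD sum_distrib_left)
  then show ?thesis unfolding euler_pairing_def by (subst sum.swap) simp
qed

lemma euler_pairing_cmult_right:
  assumes "df f" "df g" "p \<in> \<Omega>"
  shows "euler_pairing N z f (\<lambda>p. a * g p) p = a * euler_pairing N z f g p"
proof -
  have "DJ J (\<lambda>q. partial_deriv (Jet z J) f q * (a * g q)) p =
        a * DJ J (\<lambda>q. partial_deriv (Jet z J) f q * g q) p" if "J \<in> multi_indices n" for J
    using total_deriv_mi_cmult[of J "\<lambda>q. partial_deriv (Jet z J) f q * g q" p a] assms that
    by (simp add: mult.left_commute df_mult df_partial_deriv)
  then show ?thesis
    unfolding euler_pairing_def sum_distrib_left by (intro sum.cong) (auto dest: mi_uptoD)
qed

text \<open>The Frechet derivative of a product is \<open>g\<close> times that of \<open>f\<close>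
  plus \<open>f\<close> times that of \<open>g\<close>; in the adjoint these multiplications move
  onto the argument \<open>h\<close>.\<close>

lemma euler_pairing_mult_left:
  assumes "df f" "df g" "df h" "p \<in> \<Omega>"
  shows "euler_pairing N z (\<lambda>p. f p * g p) h p =
    euler_pairing N z f (\<lambda>p. g p * h p) p + euler_pairing N z g (\<lambda>p. f p * h p) p"
proof -
  have "DJ J (\<lambda>q. partial_deriv (Jet z J) (\<lambda>p. f p * g p) q * h q) p =
        DJ J (\<lambda>q. partial_deriv (Jet z J) f q * (g q * h q)) p +
        DJ J (\<lambda>q. partial_deriv (Jet z J) g q * (f q * h q)) p" if "J \<in> multi_indices n" for J
  proof -
    have "DJ J (\<lambda>q. partial_deriv (Jet z J) (\<lambda>p. f p * g p) q * h q) p =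
        DJ J (\<lambda>q. partial_deriv (Jet z J) f q * (g q * h q) +
                  partial_deriv (Jet z J) g q * (f q * h q)) p"
      using assms by (intro total_deriv_mi_cong)
        (auto simp: partial_deriv_mult df_smooth algebra_simps)
    then show ?thesis
      using assms that by (simp add: total_deriv_mi_add df_mult df_partial_deriv)
  qed
  then show ?thesis
    unfolding euler_pairing_def sum.distrib[symmetric]
    by (intro sum.cong) (auto simp: distrib_left dest: mi_uptoD)
qed

text \<open>The Frechet derivative of \<open>D i f\<close> is \<open>D i\<close> composed with that
  of \<open>f\<close>, and the formal adjoint of \<open>D i\<close> is its negative. The cutoff is
  \<open>Suc N\<close> on the left because \<open>D i f\<close> has order one higher.\<close>

lemma euler_pairing_total_deriv:
  assumes f: "ord N f" and g: "df g" and i: "i < n" and z: "z \<in> Z" and p: "p \<in> \<Omega>"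
  shows "euler_pairing (Suc N) z (D i f) g p = - euler_pairing N z f (D i g) p"
proof -
  let ?P = "\<lambda>J. partial_deriv (Jet z J) f"
  have df: "df f" using f by (rule df_ord)
  have "euler_pairing (Suc N) z (D i f) g p =
     (\<Sum>J\<in>mi_upto n (Suc N). (-1) ^ mi_size n J * DJ J (\<lambda>q. D i (?P J) q * g q) p +
        (if J i = 0 then 0 else (-1) ^ mi_size n J * DJ J (\<lambda>q. ?P (lower_mi i J) q * g q) p))"
    unfolding euler_pairing_def
  proof (rule sum.cong[OF refl])
    fix J assume "J \<in> mi_upto n (Suc N)"
    then have J: "J \<in> multi_indices n" by (rule mi_uptoD)
    have "DJ J (\<lambda>q. partial_deriv (Jet z J) (D i f) q * g q) p =
          DJ J (\<lambda>q. D i (?P J) q * g q + (if J i = 0 then 0 else ?P (lower_mi i J) q) * g q) p"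
      using df i z J p
      by (intro total_deriv_mi_cong) (simp_all add: partial_deriv_Jet_total_deriv distrib_right)
    also have "\<dots> = DJ J (\<lambda>q. D i (?P J) q * g q) p +
          DJ J (\<lambda>q. (if J i = 0 then 0 else ?P (lower_mi i J) q) * g q) p"
    proof (rule total_deriv_mi_add)
      have "df (\<lambda>q. if J i = 0 then 0 else ?P (lower_mi i J) q)"
      using df by (cases "J i = 0") auto
      then show "df (\<lambda>q. (if J i = 0 then 0 else ?P (lower_mi i J) q) * g q)"
        using g by (rule df_mult)
    qed (use df g i J p in auto)
    finally show "(-1) ^ mi_size n J * DJ J (\<lambda>q. partial_deriv (Jet z J) (D i f) q * g q) p =
       (-1) ^ mi_size n J * DJ J (\<lambda>q. D i (?P J) q * g q) p +
        (if J i = 0 then 0 else (-1) ^ mi_size n J * DJ J (\<lambda>q. ?P (lower_mi i J) q * g q) p)"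
      using J p by (simp add: distrib_left)
  qed
  also have "\<dots> = (\<Sum>J\<in>mi_upto n (Suc N). (-1) ^ mi_size n J * DJ J (\<lambda>q. D i (?P J) q * g q) p)
     + (\<Sum>J\<in>mi_upto n N. (-1) ^ mi_size n (raise_mi i J) * DJ (raise_mi i J) (\<lambda>q. ?P J q * g q) p)"
    unfolding sum.distrib by (subst sum_mi_upto_lower[OF i]) simp
  \<comment> \<open>The partial derivatives of \<open>f\<close> beyond order \<open>N\<close> vanish
    on \<Omega>, so this sum stops at \<open>N\<close> as well and can be merged with the shifted
    one.\<close>
  also have "(\<Sum>J\<in>mi_upto n (Suc N). (-1) ^ mi_size n J * DJ J (\<lambda>q. D i (?P J) q * g q) p)
     = (\<Sum>J\<in>mi_upto n N. (-1) ^ mi_size n J * DJ J (\<lambda>q. D i (?P J) q * g q) p)"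
  proof (rule sum_mi_upto_mono)
    fix J assume J: "J \<in> multi_indices n" "J \<notin> mi_upto n N"
    have "D i (?P J) q = 0" if "q \<in> \<Omega>" for q
    proof -
      have "D i (?P J) q = D i (\<lambda>_. 0) q"
        using f J that by (intro total_deriv_cong) (auto simp: partial_deriv_jet_eq_0)
      then show ?thesis by simp
    qed
    then have "DJ J (\<lambda>q. D i (?P J) q * g q) p = DJ J (\<lambda>_. 0) p"
      using p by (intro total_deriv_mi_cong) auto
    then show "(-1) ^ mi_size n J * DJ J (\<lambda>q. D i (?P J) q * g q) p = 0"
      using J p by simp
  qed simp
  also have "\<dots> + (\<Sum>J\<in>mi_upto n N.
      (-1) ^ mi_size n (raise_mi i J) * DJ (raise_mi i J) (\<lambda>q. ?P J q * g q) p) =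
    (\<Sum>J\<in>mi_upto n N. - ((-1) ^ mi_size n J * DJ J (\<lambda>q. ?P J q * D i g q) p))"
    unfolding sum.distrib[symmetric]
  proof (rule sum.cong[OF refl])
    fix J assume "J \<in> mi_upto n N"
    then have J: "J \<in> multi_indices n" by (rule mi_uptoD)
    \<comment> \<open>The raised index carries the opposite sign, so the part in which
      \<open>D i\<close> falls on the partial derivative of \<open>f\<close> cancels and only
      \<open>D i g\<close> remains.\<close>
    have "DJ (raise_mi i J) (\<lambda>q. ?P J q * g q) p = DJ J (\<lambda>q. D i (?P J) q * g q + ?P J q * D i g q) p"
      using df g i p
      by (auto simp: total_deriv_mi_raise' df_mult df_partial_deriv total_deriv_mult
          intro!: total_deriv_mi_cong)
    also have "\<dots> = DJ J (\<lambda>q. D i (?P J) q * g q) p + DJ J (\<lambda>q. ?P J q * D i g q) p"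
      using df g i J p by (intro total_deriv_mi_add) auto
    finally show "(-1) ^ mi_size n J * DJ J (\<lambda>q. D i (?P J) q * g q) p +
        (-1) ^ mi_size n (raise_mi i J) * DJ (raise_mi i J) (\<lambda>q. ?P J q * g q) p =
        - ((-1) ^ mi_size n J * DJ J (\<lambda>q. ?P J q * D i g q) p)"
      using i by (simp add: algebra_simps)
  qed
  finally show ?thesis by (simp add: euler_pairing_def sum_negf)
qed

lemma ord_total_deriv_mi:
  assumes "ord N f" "K \<in> multi_indices n"
  shows "ord (N + mi_size n K) (DJ K f)"
  using assms(2)
proof (induction K rule: multi_index_induct)
  case (raise K i)
  then have "ord (Suc (N + mi_size n K)) (D i (DJ K f))" by (intro ord_total_deriv)
  then have "ord (Suc (N + mi_size n K)) (DJ (raise_mi i K) f)"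
    by (rule ord_cong[rotated]) (use assms raise in \<open>auto simp: total_deriv_mi_raise df_ord\<close>)
  then show ?case using raise by simp
qed (use assms in simp)

lemma euler_pairing_total_deriv_mi:
  assumes f: "ord N f" and g: "df g" and z: "z \<in> Z" and K: "K \<in> multi_indices n" and p: "p \<in> \<Omega>"
  shows "euler_pairing (N + mi_size n K) z (DJ K f) g p =
    (-1) ^ mi_size n K * euler_pairing N z f (DJ K g) p"
  using K g
proof (induction K arbitrary: g rule: multi_index_induct)
  case (raise K i)
  have df: "df f" using f by (rule df_ord)
  have "euler_pairing (N + mi_size n (raise_mi i K)) z (DJ (raise_mi i K) f) g p
      = euler_pairing (Suc (N + mi_size n K)) z (D i (DJ K f)) g p"
    using raise.hyps df p by (auto simp: total_deriv_mi_raise intro!: euler_pairing_cong)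
  also have "\<dots> = - euler_pairing (N + mi_size n K) z (DJ K f) (D i g) p"
    using raise f z p by (intro euler_pairing_total_deriv ord_total_deriv_mi) auto
  also have "\<dots> = - ((-1) ^ mi_size n K * euler_pairing N z f (DJ K (D i g)) p)"
    using raise by auto
  also have "euler_pairing N z f (DJ K (D i g)) p = euler_pairing N z f (DJ (raise_mi i K) g) p"
    using raise p by (intro euler_pairing_cong) (auto simp: total_deriv_mi_raise')
  finally show ?case using raise.hyps by simp
qed simp

text \<open>Integration by parts against the constant 1, whose total derivatives vanish.\<close>

lemma euler_total_deriv_eq_0:
  assumes "df f" "i < n" "z \<in> Z" "p \<in> \<Omega>"
  shows "euler z (D i f) p = 0"
proof -
  obtain N where N: "ord N f" using assms(1) unfolding diff_fun_def by blast
  have "euler z (D i f) p = - euler_pairing N z f (D i (\<lambda>_. 1)) p"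
    using euler_eq[OF ord_total_deriv[OF N assms(2)] assms(4)]
      euler_pairing_total_deriv[OF N df_const assms(2-4)] by simp
  also have "D i (\<lambda>_. 1) = (\<lambda>_. 0)" by (simp add: fun_eq_iff)
  also have "euler_pairing N z f (\<lambda>_. 0) p = 0"
    using assms(4) by (auto simp: euler_pairing_def intro!: sum.neutral dest: mi_uptoD)
  finally show ?thesis by simp
qed

subsection \<open>Evolutionary vector fields and prolongations\<close>

text \<open>The prolonged evolutionary field with characteristic \<open>W\<close>. Splitting it off
  from \<open>prolong\<close> pays because, unlike a general prolongation, it commutes with total
  derivatives.\<close>

definition evol :: "('z \<Rightarrow> 'z jet \<Rightarrow> real) \<Rightarrow> ('z jet \<Rightarrow> real) \<Rightarrow> 'z jet \<Rightarrow> real" where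
  "evol W f p = (\<Sum>z\<in>Z. \<Sum>\<^sub>\<infinity>J\<in>multi_indices n. DJ J (W z) p * partial_deriv (Jet z J) f p)"

lemma prolong_eq_evol:
  "prolong n Z \<xi> \<zeta> f p = (\<Sum>i<n. \<xi> i p * D i f p) + evol (characteristic n \<xi> \<zeta>) f p"
  by (simp add: prolong_def evol_def)

lemma evol_eq:
  assumes "ord N f" "p \<in> \<Omega>"
  shows "evol W f p = (\<Sum>z\<in>Z. \<Sum>J\<in>mi_upto n N. DJ J (W z) p * partial_deriv (Jet z J) f p)"
  unfolding evol_def
  using assms by (subst infsum_multi_indices[of n N]) (auto simp: partial_deriv_jet_eq_0)

lemma evol_cong:
  assumes "\<And>q. q \<in> \<Omega> \<Longrightarrow> f q = g q" "p \<in> \<Omega>"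
  shows "evol W f p = evol W g p"
proof -
  have "partial_deriv c f p = partial_deriv c g p" for c
    using assms by (rule partial_deriv_cong)
  then show ?thesis by (simp add: evol_def)
qed

lemma df_evol [intro]:
  assumes "df f" "\<And>z. z \<in> Z \<Longrightarrow> df (W z)"
  shows "df (evol W f)"
proof -
  obtain N where "ord N f" using assms(1) unfolding diff_fun_def by blast
  then show ?thesis
    by (rule df_cong[OF evol_eq[symmetric]])
       (use assms in \<open>auto intro!: df_sum df_mult\<close>)
qed

lemma evol_add:
  assumes "df f" "df g" "p \<in> \<Omega>"
  shows "evol W (\<lambda>p. f p + g p) p = evol W f p + evol W g p"
proof -
  obtain N where N: "ord N f" "ord N g"
    using assms by (metis df_obtain_ord ord_mono)
  have "ord N (\<lambda>p. f p + g p)" using N by blast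
  from evol_eq[OF this assms(3), of W] show ?thesis
    using assms N ord_smooth
    by (simp add: evol_eq[OF N(1)] evol_eq[OF N(2)] partial_deriv_add distrib_left sum.distrib)
qed

lemma evol_mult:
  assumes "df f" "df g" "p \<in> \<Omega>"
  shows "evol W (\<lambda>p. f p * g p) p = evol W f p * g p + f p * evol W g p"
proof -
  obtain N where N: "ord N f" "ord N g"
    using assms by (metis df_obtain_ord ord_mono)
  have "ord N (\<lambda>p. f p * g p)" using N by blast
  from evol_eq[OF this assms(3), of W] show ?thesis
    using assms N ord_smooth
    by (simp add: evol_eq[OF N(1)] evol_eq[OF N(2)] partial_deriv_mult
        algebra_simps sum.distrib sum_distrib_left)
qed

lemma evol_const [simp]: "evol W (\<lambda>_. a) p = 0"
  by (simp add: evol_def)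

lemma evol_sum:
  "(\<And>k. k \<in> A \<Longrightarrow> df (f k)) \<Longrightarrow> p \<in> \<Omega> \<Longrightarrow> evol W (\<lambda>p. \<Sum>k\<in>A. f k p) p = (\<Sum>k\<in>A. evol W (f k) p)"
  by (induction A rule: infinite_finite_induct) (auto simp: evol_add df_sum)

text \<open>The commutator formula splits the left side in two. One part differentiates the partial
  derivatives of \<open>f\<close>; the other, after an index shift, differentiates the coefficients
  \<open>DJ J (W z)\<close>. Together they are the product rule for \<open>D i\<close>.\<close>

lemma evol_total_deriv:
  assumes f: "df f" and W: "\<And>z. z \<in> Z \<Longrightarrow> df (W z)" and i: "i < n" and p: "p \<in> \<Omega>"
  shows "evol W (D i f) p = D i (evol W f) p"
proof -
  obtain N where N: "ord N f" using f unfolding diff_fun_def by blast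
  let ?P = "\<lambda>z J. partial_deriv (Jet z J) f"
  have "evol W (D i f) p =
     (\<Sum>z\<in>Z. \<Sum>J\<in>mi_upto n (Suc N). DJ J (W z) p * partial_deriv (Jet z J) (D i f) p)"
    by (rule evol_eq[OF ord_total_deriv[OF N i] p])
  also have "\<dots> = (\<Sum>z\<in>Z. (\<Sum>J\<in>mi_upto n (Suc N). DJ J (W z) p * D i (?P z J) p) +
     (\<Sum>J\<in>mi_upto n (Suc N). if J i = 0 then 0 else DJ J (W z) p * ?P z (lower_mi i J) p))"
    unfolding sum.distrib[symmetric]
    by (intro sum.cong refl)
       (auto simp: partial_deriv_Jet_total_deriv f i p distrib_left dest: mi_uptoD)
  also have "\<dots> = (\<Sum>z\<in>Z. (\<Sum>J\<in>mi_upto n N. DJ J (W z) p * D i (?P z J) p) +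
     (\<Sum>J\<in>mi_upto n N. DJ (raise_mi i J) (W z) p * ?P z J p))"
  proof (rule sum.cong[OF refl], rule arg_cong2[where f = "(+)"])
    fix z
    show "(\<Sum>J\<in>mi_upto n (Suc N). DJ J (W z) p * D i (?P z J) p) =
          (\<Sum>J\<in>mi_upto n N. DJ J (W z) p * D i (?P z J) p)"
    proof (rule sum_mi_upto_mono)
      fix J assume "J \<notin> mi_upto n N"
      then have "D i (?P z J) p = D i (\<lambda>_. 0) p"
        using N p by (intro total_deriv_cong) (auto simp: partial_deriv_jet_eq_0)
      then show "DJ J (W z) p * D i (?P z J) p = 0" by simp
    qed simp
    show "(\<Sum>J\<in>mi_upto n (Suc N). if J i = 0 then 0 else DJ J (W z) p * ?P z (lower_mi i J) p) =
          (\<Sum>J\<in>mi_upto n N. DJ (raise_mi i J) (W z) p * ?P z J p)"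
      by (rule sum_mi_upto_lower[OF i])
  qed
  also have "\<dots> = D i (\<lambda>p. \<Sum>z\<in>Z. \<Sum>J\<in>mi_upto n N. DJ J (W z) p * ?P z J p) p"
    using f W i p
    by (simp add: total_deriv_sum total_deriv_mult total_deriv_mi_raise df_sum df_mult
        df_partial_deriv df_total_deriv_mi sum.distrib add.commute)
  also have "\<dots> = D i (evol W f) p"
    by (rule total_deriv_cong[OF evol_eq[OF N, symmetric] p])
  finally show ?thesis .
qed

lemma evol_total_deriv_mi:
  assumes f: "df f" and W: "\<And>z. z \<in> Z \<Longrightarrow> df (W z)" and "J \<in> multi_indices n" and "p \<in> \<Omega>"
  shows "evol W (DJ J f) p = DJ J (evol W f) p"
  using assms(3,4)
proof (induction J arbitrary: p rule: multi_index_induct)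
  case (raise J i)
  have "evol W (DJ (raise_mi i J) f) p = evol W (D i (DJ J f)) p"
    using raise f by (intro evol_cong) (auto simp: total_deriv_mi_raise)
  also have "\<dots> = D i (evol W (DJ J f)) p"
    using raise f W by (intro evol_total_deriv) auto
  also have "\<dots> = D i (DJ J (evol W f)) p"
    using raise by (intro total_deriv_cong) auto
  also have "\<dots> = DJ (raise_mi i J) (evol W f) p"
    using raise f W by (simp add: total_deriv_mi_raise df_evol)
  finally show ?case .
qed simp

text \<open>By the product rule for pairings each summand \<open>DJ K (W z)\<close> times dL/dz_K
  contributes twice. Integration by parts in the first contribution assembles
  \<open>euler z L\<close> as the argument of the pairing with \<open>W z\<close>; in the second,
  \<open>evol W\<close> commutes past the derivatives that make up
  \<open>euler z0 L\<close>.\<close>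

lemma euler_evol:
  assumes L: "df L" and WN: "\<And>z. z \<in> Z \<Longrightarrow> ord NW (W z)" and z0: "z0 \<in> Z" and p: "p \<in> \<Omega>"
  shows "euler z0 (evol W L) p =
    evol W (euler z0 L) p + (\<Sum>z\<in>Z. euler_pairing NW z0 (W z) (euler z L) p)"
proof -
  obtain N where N: "ord N L" using L unfolding diff_fun_def by blast
  have W: "\<And>z. z \<in> Z \<Longrightarrow> df (W z)" using WN df_ord by blast
  let ?P = "\<lambda>z J. partial_deriv (Jet z J)"
  \<comment> \<open>One cutoff for all pairings: it bounds the orders of \<open>evol W L\<close>, of
    L, and of \<open>DJ K (W z)\<close> for K of size at most \<open>N\<close>.\<close>
  obtain B where B: "NW + N \<le> B" "ord B (evol W L)"
    using df_obtain_ord[OF df_evol[OF L, of W]] W by blast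
  have first: "(\<Sum>K\<in>mi_upto n N. euler_pairing B z0 (DJ K (W z)) (?P z K L) p) =
      euler_pairing NW z0 (W z) (euler z L) p" if z: "z \<in> Z" for z
  proof -
    have "(\<Sum>K\<in>mi_upto n N. euler_pairing B z0 (DJ K (W z)) (?P z K L) p) =
        (\<Sum>K\<in>mi_upto n N.
           euler_pairing NW z0 (W z) (\<lambda>p. (-1) ^ mi_size n K * DJ K (?P z K L) p) p)"
    proof (rule sum.cong[OF refl])
      fix K assume K: "K \<in> mi_upto n N"
      then have "NW + mi_size n K \<le> B" using B(1) by (simp add: mi_upto_def)
      then have "euler_pairing B z0 (DJ K (W z)) (?P z K L) p =
          euler_pairing (NW + mi_size n K) z0 (DJ K (W z)) (?P z K L) p"
        using WN[OF z] K p by (intro euler_pairing_mono ord_total_deriv_mi) (auto dest: mi_uptoD)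
      also have "\<dots> = (-1) ^ mi_size n K * euler_pairing NW z0 (W z) (DJ K (?P z K L)) p"
        using WN[OF z] K p L z0 by (intro euler_pairing_total_deriv_mi) (auto dest: mi_uptoD)
      also have "\<dots> = euler_pairing NW z0 (W z) (\<lambda>p. (-1) ^ mi_size n K * DJ K (?P z K L) p) p"
        using W[OF z] L p by (intro euler_pairing_cmult_right[symmetric]) auto
      finally show "euler_pairing B z0 (DJ K (W z)) (?P z K L) p =
          euler_pairing NW z0 (W z) (\<lambda>p. (-1) ^ mi_size n K * DJ K (?P z K L) p) p" .
    qed
    also have "\<dots> = euler_pairing NW z0 (W z)
        (\<lambda>p. \<Sum>K\<in>mi_upto n N. (-1) ^ mi_size n K * DJ K (?P z K L) p) p"
      using W[OF z] L p
      by (intro euler_pairing_sum_right[symmetric] df_mult df_const df_total_deriv_mi) auto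
    also have "\<dots> = euler_pairing NW z0 (W z) (euler z L) p"
      using p by (intro euler_pairing_cong) (auto simp: euler_eq[OF N] euler_pairing_def)
    finally show ?thesis .
  qed
  have second: "(\<Sum>z\<in>Z. \<Sum>K\<in>mi_upto n N. euler_pairing B z0 (?P z K L) (DJ K (W z)) p) =
      evol W (euler z0 L) p"
  proof -
    have "(\<Sum>z\<in>Z. \<Sum>K\<in>mi_upto n N. euler_pairing B z0 (?P z K L) (DJ K (W z)) p) =
      (\<Sum>z\<in>Z. \<Sum>K\<in>mi_upto n N. \<Sum>J\<in>mi_upto n N.
         (-1) ^ mi_size n J * DJ J (\<lambda>q. ?P z0 J (?P z K L) q * DJ K (W z) q) p)"
      using B(1) by (intro sum.cong refl
          trans[OF euler_pairing_mono[OF ord_partial_deriv[OF N] _ p] euler_pairing_def]) auto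
    also have "\<dots> = (\<Sum>J\<in>mi_upto n N. \<Sum>z\<in>Z. \<Sum>K\<in>mi_upto n N.
         (-1) ^ mi_size n J * DJ J (\<lambda>q. ?P z0 J (?P z K L) q * DJ K (W z) q) p)"
      by (subst (2) sum.swap, subst sum.swap) simp
    also have "\<dots> = (\<Sum>J\<in>mi_upto n N. evol W (\<lambda>p. (-1) ^ mi_size n J * DJ J (?P z0 J L) p) p)"
    proof (rule sum.cong[OF refl])
      fix J assume "J \<in> mi_upto n N"
      then have J: "J \<in> multi_indices n" by (rule mi_uptoD)
      have "(\<Sum>z\<in>Z. \<Sum>K\<in>mi_upto n N. DJ J (\<lambda>q. ?P z0 J (?P z K L) q * DJ K (W z) q) p) =
          DJ J (\<lambda>q. \<Sum>z\<in>Z. \<Sum>K\<in>mi_upto n N. ?P z0 J (?P z K L) q * DJ K (W z) q) p"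
        using L W J p
        by (simp add: total_deriv_mi_sum df_sum df_mult df_partial_deriv df_total_deriv_mi)
      \<comment> \<open>Symmetry of mixed partials lets the derivative in \<open>Jet z0 J\<close>
        act on L first, which leaves the expansion of \<open>evol W\<close>.\<close>
      also have "\<dots> = DJ J (evol W (?P z0 J L)) p"
        using p by (intro total_deriv_mi_cong)
          (auto simp: evol_eq[OF ord_partial_deriv[OF N]] mult.commute
             partial_deriv_commute[OF ord_smooth[OF N], of _ "Jet z0 J"])
      also have "\<dots> = evol W (DJ J (?P z0 J L)) p"
        using L W J p by (intro evol_total_deriv_mi[symmetric]) auto
      finally show "(\<Sum>z\<in>Z. \<Sum>K\<in>mi_upto n N.
         (-1) ^ mi_size n J * DJ J (\<lambda>q. ?P z0 J (?P z K L) q * DJ K (W z) q) p) =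
         evol W (\<lambda>p. (-1) ^ mi_size n J * DJ J (?P z0 J L) p) p"
        using L p by (simp add: sum_distrib_left[symmetric] evol_mult df_const df_partial_deriv
            df_total_deriv_mi)
    qed
    also have "\<dots> = evol W (\<lambda>p. \<Sum>J\<in>mi_upto n N. (-1) ^ mi_size n J * DJ J (?P z0 J L) p) p"
      using L p by (intro evol_sum[symmetric] df_mult df_const df_total_deriv_mi) auto
    also have "\<dots> = evol W (euler z0 L) p"
      using p by (intro evol_cong) (auto simp: euler_eq[OF N] euler_pairing_def)
    finally show ?thesis .
  qed
  have "euler z0 (evol W L) p = euler_pairing B z0 (evol W L) (\<lambda>_. 1) p"
    by (rule euler_eq[OF B(2) p])
  also have "\<dots> = euler_pairing B z0
      (\<lambda>p. \<Sum>z\<in>Z. \<Sum>K\<in>mi_upto n N. DJ K (W z) p * ?P z K L p) (\<lambda>_. 1) p"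
    using p by (intro euler_pairing_cong) (auto simp: evol_eq[OF N])
  also have "\<dots> = (\<Sum>z\<in>Z. \<Sum>K\<in>mi_upto n N.
      euler_pairing B z0 (DJ K (W z)) (?P z K L) p + euler_pairing B z0 (?P z K L) (DJ K (W z)) p)"
    using L W p by (simp add: euler_pairing_sum_left euler_pairing_mult_left df_sum df_mult
        df_const df_partial_deriv df_total_deriv_mi)
  also have "\<dots> = (\<Sum>z\<in>Z. euler_pairing NW z0 (W z) (euler z L) p) + evol W (euler z0 L) p"
    using first second by (simp add: sum.distrib)
  finally show ?thesis by simp
qed

lemma df_characteristic:
  assumes "\<And>i. i < n \<Longrightarrow> df (\<xi> i)" "df (\<zeta> z)" "z \<in> Z"
  shows "df (characteristic n \<xi> \<zeta> z)"
  unfolding characteristic_def[abs_def]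
  using assms by (intro df_diff df_sum df_mult df_jet multi_indices_upd) auto

lemma prolong_mult:
  assumes "df f" "df g" "p \<in> \<Omega>"
  shows "prolong n Z \<xi> \<zeta> (\<lambda>p. f p * g p) p = prolong n Z \<xi> \<zeta> f p * g p + f p * prolong n Z \<xi> \<zeta> g p"
  using assms by (simp add: prolong_eq_evol total_deriv_mult evol_mult
      algebra_simps sum.distrib sum_distrib_left)

lemma prolong_add:
  assumes "df f" "df g" "p \<in> \<Omega>"
  shows "prolong n Z \<xi> \<zeta> (\<lambda>p. f p + g p) p = prolong n Z \<xi> \<zeta> f p + prolong n Z \<xi> \<zeta> g p"
  using assms by (simp add: prolong_eq_evol total_deriv_add evol_add distrib_left sum.distrib)

lemma prolong_const [simp]: "prolong n Z \<xi> \<zeta> (\<lambda>_. a) p = 0"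
  by (simp add: prolong_eq_evol)

lemma prolong_sum:
  "(\<And>k. k \<in> A \<Longrightarrow> df (f k)) \<Longrightarrow> p \<in> \<Omega> \<Longrightarrow>
    prolong n Z \<xi> \<zeta> (\<lambda>p. \<Sum>k\<in>A. f k p) p = (\<Sum>k\<in>A. prolong n Z \<xi> \<zeta> (f k) p)"
  by (induction A rule: infinite_finite_induct) (auto simp: prolong_add df_sum)

text \<open>The term with z_(x^i) subtracted in the characteristic is restored by the total
  derivative part of the prolongation.\<close>

lemma prolong_dep_val:
  assumes z: "z \<in> Z" and p: "p \<in> \<Omega>"
  shows "prolong n Z \<xi> \<zeta> (dep_val z) p = \<zeta> z p"
proof -
  let ?W = "characteristic n \<xi> \<zeta>"
  have "evol ?W (dep_val z) p = (\<Sum>z'\<in>Z. \<Sum>J\<in>mi_upto n 0.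
      if z' = z then if J = (\<lambda>_. 0) then ?W z p else 0 else 0)"
    using evol_eq[OF ord_jet[OF z zero_in_mi_upto, of 0] p, of ?W]
    by (auto simp: partial_deriv_coord intro!: sum.cong)
  also have "\<dots> = (\<Sum>z'\<in>Z. if z' = z then ?W z p else 0)"
    by (intro sum.cong refl) (simp add: sum.delta)
  also have "\<dots> = ?W z p" using z by (simp add: sum.delta)
  finally show ?thesis
    using z p by (simp add: prolong_eq_evol total_deriv_jet characteristic_def)
qed

text \<open>
  The hypothesis says that the action functional of \<open>L\<close> is invariant. Hence \<open>evol W L\<close> is a total
  divergence, which \<open>euler z\<close> annihilates.
\<close>
lemma prolong_euler_eq_0:
  assumes L: "df L" and xi: "\<And>i. i < n \<Longrightarrow> df (\<xi> i)" and zeta: "\<And>z. z \<in> Z \<Longrightarrow> df (\<zeta> z)"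
    and inv: "\<And>q. q \<in> \<Omega> \<Longrightarrow> prolong n Z \<xi> \<zeta> L q + L q * total_div n Z \<xi> q = 0"
    and z0: "z0 \<in> Z" and p: "p \<in> \<Omega>"
    and sol: "\<And>z K. z \<in> Z \<Longrightarrow> K \<in> multi_indices n \<Longrightarrow> DJ K (euler z L) p = 0"
  shows "prolong n Z \<xi> \<zeta> (euler z0 L) p = 0"
proof -
  let ?W = "characteristic n \<xi> \<zeta>"
  have W: "df (?W z)" if "z \<in> Z" for z
    using that xi zeta by (intro df_characteristic)
  obtain NW where NW: "\<And>z. z \<in> Z \<Longrightarrow> ord NW (?W z)"
    using df_common_ord[OF finite_Z, of ?W] W by blast
  let ?G = "\<lambda>p. \<Sum>i<n. D i (\<lambda>p. - (\<xi> i p * L p)) p"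
  have xiL: "df (\<lambda>p. - (\<xi> i p * L p))" if "i < n" for i
    using xi[OF that] L by (intro df_minus df_mult)
  \<comment> \<open>The product rule turns the divergence of -\<xi> L into minus the transport term
    of \<open>prolong\<close> minus L times Div \<xi>, which is \<open>evol ?W L\<close> by
    \<open>inv\<close>.\<close>
  have div: "evol ?W L q = ?G q" if q: "q \<in> \<Omega>" for q
  proof -
    have "D i (\<lambda>p. - (\<xi> i p * L p)) q = - (\<xi> i q * D i L q) - L q * D i (\<xi> i) q" if "i < n" for i
      using total_deriv_mult[of "\<lambda>_. - 1" "\<lambda>p. \<xi> i p * L p" q i] total_deriv_mult[OF xi L q, of i i]
        that xi L q by (simp add: df_mult df_const algebra_simps)
    then have "?G q = - (\<Sum>i<n. \<xi> i q * D i L q) - L q * total_div n Z \<xi> q"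
      by (simp add: sum_subtractf sum_negf sum_distrib_left total_div_def)
    then show ?thesis using inv[OF q] by (simp add: prolong_eq_evol)
  qed
  obtain N where N: "ord N (evol ?W L)" using df_evol[OF L, of ?W] W unfolding diff_fun_def by blast
  have "euler z0 (evol ?W L) p = 0"
  proof -
    have DxiL: "df (D i (\<lambda>p. - (\<xi> i p * L p)))" if "i \<in> {..<n}" for i
      using that xiL by auto
    \<comment> \<open>At a common order every variational derivative becomes a finite pairing, and
      additivity is available for pairings.\<close>
    obtain M where M: "N \<le> M" "\<And>i. i \<in> {..<n} \<Longrightarrow> ord M (D i (\<lambda>p. - (\<xi> i p * L p)))"
      by (rule df_common_ord[of "{..<n}" "\<lambda>i. D i (\<lambda>p. - (\<xi> i p * L p))" N])
         (auto intro: DxiL)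
    have "euler z0 (evol ?W L) p = euler_pairing M z0 (evol ?W L) (\<lambda>_. 1) p"
      by (rule euler_eq[OF ord_mono[OF N M(1)] p])
    also have "\<dots> = euler_pairing M z0 ?G (\<lambda>_. 1) p"
      using p div by (intro euler_pairing_cong) auto
    also have "\<dots> = (\<Sum>i<n. euler_pairing M z0 (D i (\<lambda>p. - (\<xi> i p * L p))) (\<lambda>_. 1) p)"
      using xiL p by (intro euler_pairing_sum_left) auto
    also have "\<dots> = (\<Sum>i<n. euler z0 (D i (\<lambda>p. - (\<xi> i p * L p))) p)"
      using M(2) p by (intro sum.cong refl euler_eq[symmetric])
    also have "\<dots> = 0"
      using xiL z0 p by (intro sum.neutral) (auto intro: euler_total_deriv_eq_0)
    finally show ?thesis .
  qed
  \<comment> \<open>Each term is a total derivative of a product with \<open>euler z L\<close>, all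
    of whose total derivatives vanish at \<open>p\<close>.\<close>
  moreover have "euler_pairing NW z0 (?W z) (euler z L) p = 0" if "z \<in> Z" for z
    unfolding euler_pairing_def
    using that W L p sol
    by (intro sum.neutral ballI) (auto dest!: mi_uptoD intro!: total_deriv_mi_mult_eq_0)
  ultimately have "evol ?W (euler z0 L) p = 0"
    using euler_evol[OF L NW z0 p] by simp
  \<comment> \<open>This is \<open>sol\<close> for the unit multi-index in direction
    \<open>i\<close>; it removes the difference between \<open>evol\<close> and
    \<open>prolong\<close> at \<open>p\<close>.\<close>
  moreover have "D i (euler z0 L) p = 0" if "i < n" for i
    using sol[OF z0 multi_indices_upd[OF that zero_in_multi_indices, of "Suc 0"]] that L p
      total_deriv_mi_raise[of "euler z0 L" i p "\<lambda>_. 0"] by (simp add: df_euler)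
  ultimately show ?thesis by (simp add: prolong_eq_evol)
qed

section \<open>Enlarging the set of dependent variables\<close>

lemma diff_fun_order_subset:
  assumes "Z0 \<subseteq> Z" "diff_fun_order \<Omega> n Z0 N f"
  shows "ord N f"
  using assms unfolding diff_fun_order_iff by (auto elim!: depends_on_mono simp: jet_coords_def)

lemma diff_fun_subset: "Z0 \<subseteq> Z \<Longrightarrow> diff_fun \<Omega> n Z0 f \<Longrightarrow> df f"
  using diff_fun_order_subset unfolding diff_fun_def by blast

lemma partial_deriv_other_var_eq_0:
  assumes "diff_fun \<Omega> n Z0 f" "z \<notin> Z0" "p \<in> \<Omega>"
  shows "partial_deriv (Jet z J) f p = 0"
  using assms unfolding diff_fun_def diff_fun_order_iff
  by (auto intro!: partial_deriv_eq_0 simp: jet_coords_def)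

lemma total_deriv_subset:
  assumes sub: "Z0 \<subseteq> Z" and f: "diff_fun \<Omega> n Z0 f" and p: "p \<in> \<Omega>"
  shows "total_deriv n Z0 i f p = D i f p"
proof -
  have "(\<Sum>z\<in>Z. \<Sum>\<^sub>\<infinity>J\<in>multi_indices n. p (Jet z (raise_mi i J)) * partial_deriv (Jet z J) f p)
      = (\<Sum>z\<in>Z0. \<Sum>\<^sub>\<infinity>J\<in>multi_indices n. p (Jet z (raise_mi i J)) * partial_deriv (Jet z J) f p)"
    using sub partial_deriv_other_var_eq_0[OF f _ p] by (intro sum.mono_neutral_right) auto
  then show ?thesis by (simp add: total_deriv_def)
qed

text \<open>A single step is \<open>total_deriv_subset\<close>; to iterate it, the intermediate
  functions must still depend on the variables in \<open>Z0\<close> only. The second interpretation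
  of the locale, at \<open>Z0\<close>, supplies this.\<close>

lemma total_deriv_mi_subset:
  assumes sub: "Z0 \<subseteq> Z" and f: "diff_fun \<Omega> n Z0 f" and "J \<in> multi_indices n" "p \<in> \<Omega>"
  shows "total_deriv_mi n Z0 J f p = DJ J f p"
proof -
  interpret Z0: jet_space \<Omega> n Z0
    by unfold_locales (rule finite_subset[OF sub finite_Z])
  show ?thesis
    using assms(3,4)
  proof (induction J arbitrary: p rule: multi_index_induct)
    case (raise J i)
    have "total_deriv_mi n Z0 (raise_mi i J) f p = total_deriv n Z0 i (total_deriv_mi n Z0 J f) p"
      using f raise by (intro Z0.total_deriv_mi_raise)
    also have "\<dots> = D i (total_deriv_mi n Z0 J f) p"
      using sub f raise by (intro total_deriv_subset) auto
    also have "\<dots> = D i (DJ J f) p"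
      using raise by (intro total_deriv_cong) auto
    also have "\<dots> = DJ (raise_mi i J) f p"
      using diff_fun_subset[OF sub f] raise by (simp add: total_deriv_mi_raise)
    finally show ?case .
  qed simp
qed

text \<open>Transfers the hypothesis on X, prolonged over \<open>state_vars\<close>, to Y, prolonged
  over \<open>all_vars\<close>: derivatives of \<open>f\<close> in the added variables vanish, so
  the new coefficients never enter.\<close>

lemma prolong_subset:
  assumes sub: "Z0 \<subseteq> Z" and f: "diff_fun \<Omega> n Z0 f" and p: "p \<in> \<Omega>"
    and xi: "\<And>i. i < n \<Longrightarrow> diff_fun \<Omega> n Z0 (\<xi> i)"
    and zeta: "\<And>z. z \<in> Z0 \<Longrightarrow> diff_fun \<Omega> n Z0 (\<zeta> z)" "\<And>z. z \<in> Z0 \<Longrightarrow> \<zeta>' z = \<zeta> z"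
  shows "prolong n Z0 \<xi> \<zeta> f p = prolong n Z \<xi> \<zeta>' f p"
proof -
  interpret Z0: jet_space \<Omega> n Z0
    by unfold_locales (rule finite_subset[OF sub finite_Z])
  have "(\<Sum>z\<in>Z. \<Sum>\<^sub>\<infinity>J\<in>multi_indices n. DJ J (characteristic n \<xi> \<zeta>' z) p * partial_deriv (Jet z J) f p)
      = (\<Sum>z\<in>Z0. \<Sum>\<^sub>\<infinity>J\<in>multi_indices n. DJ J (characteristic n \<xi> \<zeta>' z) p * partial_deriv (Jet z J) f p)"
    using sub partial_deriv_other_var_eq_0[OF f _ p] by (intro sum.mono_neutral_right) auto
  also have "\<dots> = (\<Sum>z\<in>Z0. \<Sum>\<^sub>\<infinity>J\<in>multi_indices n.
      total_deriv_mi n Z0 J (characteristic n \<xi> \<zeta> z) p * partial_deriv (Jet z J) f p)"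
  proof (intro sum.cong refl infsum_cong)
    fix z J assume z: "z \<in> Z0" and J: "J \<in> multi_indices n"
    have "characteristic n \<xi> \<zeta>' z = characteristic n \<xi> \<zeta> z"
      using zeta(2)[OF z] by (simp add: characteristic_def fun_eq_iff)
    then show "DJ J (characteristic n \<xi> \<zeta>' z) p * partial_deriv (Jet z J) f p =
        total_deriv_mi n Z0 J (characteristic n \<xi> \<zeta> z) p * partial_deriv (Jet z J) f p"
      using total_deriv_mi_subset[OF sub Z0.df_characteristic[OF xi zeta(1) z] J p] z by simp
  qed
  finally show ?thesis
    using total_deriv_subset[OF sub f p] by (simp add: prolong_def)
qed

text \<open>With no derivative of \<open>z\<close> present in \<open>L\<close>, only the zero
  multi-index contributes. Serves to recover the original equations as variational derivatives in
  the \<open>V\<close> and \<open>Vt\<close> directions.\<close>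

lemma euler_eq_self:
  assumes f: "df f" and L: "df L" and p: "p \<in> \<Omega>"
    and d0: "\<And>q. q \<in> \<Omega> \<Longrightarrow> partial_deriv (Jet z (\<lambda>_. 0)) L q = f q"
    and d: "\<And>q J. q \<in> \<Omega> \<Longrightarrow> J \<noteq> (\<lambda>_. 0) \<Longrightarrow> partial_deriv (Jet z J) L q = 0"
  shows "euler z L p = f p"
proof -
  have "(\<Sum>\<^sub>\<infinity>J\<in>multi_indices n. (-1) ^ mi_size n J * DJ J (partial_deriv (Jet z J) L) p)
      = (\<Sum>J\<in>{\<lambda>_. 0}. (-1) ^ mi_size n J * DJ J (partial_deriv (Jet z J) L) p)"
  proof -
    have "DJ J (partial_deriv (Jet z J) L) p = 0" if "J \<in> multi_indices n" "J \<noteq> (\<lambda>_. 0)" for J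
      using total_deriv_mi_cong[of "partial_deriv (Jet z J) L" "\<lambda>_. 0" p J] that d p by simp
    then show ?thesis
      by (subst infsum_cong_neutral[where T = "{\<lambda>_. 0}" and g = "\<lambda>J. (-1) ^ mi_size n J *
            DJ J (partial_deriv (Jet z J) L) p"]) auto
  qed
  then show ?thesis using d0[OF p] by (simp add: variational_deriv_def)
qed

end

subsection \<open>The adjoint system\<close>

lemma finite_all_vars [simp]: "finite (all_vars m mt)"
  by (simp add: all_vars_def state_vars_def)

lemma state_vars_subset: "state_vars m mt \<subseteq> all_vars m mt"
  by (auto simp: all_vars_def)

lemma in_all_vars [simp]:
  "U i \<in> all_vars m mt \<longleftrightarrow> i < m" "Ut i \<in> all_vars m mt \<longleftrightarrow> i < mt"
  "V i \<in> all_vars m mt \<longleftrightarrow> i < m" "Vt i \<in> all_vars m mt \<longleftrightarrow> i < mt"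
  by (auto simp: all_vars_def state_vars_def)

lemma V_notin_state_vars [simp]: "V i \<notin> state_vars m mt" "Vt i \<notin> state_vars m mt"
  and in_state_vars [simp]: "U i \<in> state_vars m mt \<longleftrightarrow> i < m" "Ut i \<in> state_vars m mt \<longleftrightarrow> i < mt"
  by (auto simp: state_vars_def)

text \<open>The coefficient that \<open>F \<beta>\<close> receives when the Lagrangian is regrouped.
  The variables v and v~ enter the Lagrangian only through these combinations.\<close>

definition multiplier :: "nat \<Rightarrow> nat \<Rightarrow> depvar jet \<Rightarrow> real" where
  "multiplier mt \<beta> p = dep_val (V \<beta>) p + (\<Sum>\<gamma><mt. dep_val (Vt \<gamma>) p)"

lemma adjoint_lagrangian_eq:
  "adjoint_lagrangian m mt F = (\<lambda>p. \<Sum>\<beta><m. multiplier mt \<beta> p * F \<beta> p)"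
  by (simp add: adjoint_lagrangian_def multiplier_def fun_eq_iff distrib_right sum.distrib
      sum_distrib_left)

text \<open>The left side is what the prolongation of Y gives on the multiplier, so the relation is
  the usual transformation law of an adjoint variable, imposed on the multiplier instead of on v and
  v~ separately.\<close>

lemma adjoint_coeff_relation_multiplier:
  "adjoint_coeff_relation \<Omega> n m mt \<xi> \<Lambda> \<eta>s \<eta>ts \<longleftrightarrow>
     (\<forall>\<beta><m. \<forall>p\<in>\<Omega>. \<eta>s \<beta> p + (\<Sum>\<alpha><mt. \<eta>ts \<alpha> p) =
        - ((\<Sum>\<alpha><m. multiplier mt \<alpha> p * \<Lambda> \<alpha> \<beta> p)
           + multiplier mt \<beta> p * total_div n (all_vars m mt) \<xi> p))"
  unfolding adjoint_coeff_relation_def multiplier_def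
  by (simp add: distrib_right sum.distrib sum_distrib_left add_ac)

theorem theorem3p2:
  fixes n m mt s :: nat
    and \<Omega> :: "depvar jet set"
    and F \<xi> \<eta> \<eta>t :: "nat \<Rightarrow> depvar jet \<Rightarrow> real"
    and \<Lambda> :: "nat \<Rightarrow> nat \<Rightarrow> depvar jet \<Rightarrow> real"
  assumes domain: "open \<Omega>"
    and F: "\<And>\<alpha>. \<alpha> < m \<Longrightarrow> diff_fun_order \<Omega> n (state_vars m mt) s (F \<alpha>)"
    and xi: "\<And>i. i < n \<Longrightarrow> diff_fun_order \<Omega> n (state_vars m mt) 0 (\<xi> i)"
    and eta: "\<And>\<beta>. \<beta> < m \<Longrightarrow> diff_fun_order \<Omega> n (state_vars m mt) 0 (\<eta> \<beta>)"
    and etat: "\<And>\<beta>. \<beta> < mt \<Longrightarrow> diff_fun_order \<Omega> n (state_vars m mt) 0 (\<eta>t \<beta>)"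
    and Lambda: "\<And>\<alpha> \<beta>. \<alpha> < m \<Longrightarrow> \<beta> < m \<Longrightarrow>
      diff_fun_order \<Omega> n (state_vars m mt) s (\<Lambda> \<alpha> \<beta>)"
    and symmetry: "\<And>\<alpha> p. \<alpha> < m \<Longrightarrow> p \<in> \<Omega> \<Longrightarrow>
      prolong n (state_vars m mt) \<xi> (X_coeffs \<eta> \<eta>t) (F \<alpha>) p = (\<Sum>\<beta><m. \<Lambda> \<alpha> \<beta> p * F \<beta> p)"
  shows
    "(\<forall>\<eta>s \<eta>ts.
        (\<forall>\<beta><m. diff_fun \<Omega> n (all_vars m mt) (\<eta>s \<beta>)) \<and>
        (\<forall>\<beta><mt. diff_fun \<Omega> n (all_vars m mt) (\<eta>ts \<beta>)) \<and>
        adjoint_coeff_relation \<Omega> n m mt \<xi> \<Lambda> \<eta>s \<eta>ts \<longrightarrow>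
        admits_symmetry \<Omega> n (all_vars m mt) (combined_system n m mt F)
          \<xi> (Y_coeffs \<eta> \<eta>t \<eta>s \<eta>ts)) \<and>
     (let \<eta>s = (\<lambda>\<beta> p. - ((\<Sum>\<alpha><m. (dep_val (V \<alpha>) p + (\<Sum>\<gamma><mt. dep_val (Vt \<gamma>) p)) * \<Lambda> \<alpha> \<beta> p)
                          + dep_val (V \<beta>) p * total_div n (all_vars m mt) \<xi> p));
          \<eta>ts = (\<lambda>\<alpha> p. - dep_val (Vt \<alpha>) p * total_div n (all_vars m mt) \<xi> p)
      in (\<forall>\<beta><m. diff_fun \<Omega> n (all_vars m mt) (\<eta>s \<beta>)) \<and>
         (\<forall>\<beta><mt. diff_fun \<Omega> n (all_vars m mt) (\<eta>ts \<beta>)) \<and>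
         adjoint_coeff_relation \<Omega> n m mt \<xi> \<Lambda> \<eta>s \<eta>ts)"
proof -
  let ?S = "state_vars m mt" and ?Z = "all_vars m mt"
  interpret jet_space \<Omega> n ?Z
    using domain by unfold_locales auto
  note sub = state_vars_subset[of m mt]
  let ?L = "adjoint_lagrangian m mt F" and ?w = "multiplier mt"
  have dS: "diff_fun \<Omega> n ?S f" if "diff_fun_order \<Omega> n ?S N f" for f N
    using that by (auto simp: diff_fun_def)
  have dfF: "df (F \<alpha>)" if "\<alpha> < m" for \<alpha>
    by (rule diff_fun_subset[OF sub dS[OF F[OF that]]])
  have dfxi: "df (\<xi> i)" if "i < n" for i
    by (rule diff_fun_subset[OF sub dS[OF xi[OF that]]])
  have dfLambda: "df (\<Lambda> \<alpha> \<beta>)" if "\<alpha> < m" "\<beta> < m" for \<alpha> \<beta>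
    by (rule diff_fun_subset[OF sub dS[OF Lambda[OF that]]])
  have dfw: "df (?w \<beta>)" if "\<beta> < m" for \<beta>
    unfolding multiplier_def[abs_def] using that by (intro df_add df_sum df_jet) auto
  have dfL: "df ?L"
    unfolding adjoint_lagrangian_eq using dfF dfw by (intro df_sum df_mult) auto
  have dfdiv: "df (total_div n ?Z \<xi>)"
    unfolding total_div_def[abs_def] using dfxi by (intro df_sum df_total_deriv) auto

  \<comment> \<open>The functions \<open>F \<beta>\<close> involve only state variables, so a
    derivative in a direction outside them hits only the multipliers.\<close>
  have deriv_L: "partial_deriv (Jet z J) ?L q = (\<Sum>\<beta><m. partial_deriv (Jet z J) (?w \<beta>) q * F \<beta> q)"
    if "z \<notin> ?S" "q \<in> \<Omega>" for z J q
  proof -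
    have "partial_deriv (Jet z J) ?L q = (\<Sum>\<beta><m. partial_deriv (Jet z J) (\<lambda>p. ?w \<beta> p * F \<beta> p) q)"
      unfolding adjoint_lagrangian_eq
      using that(2) dfF dfw by (intro partial_deriv_sum smooth_mult df_smooth) auto
    also have "\<dots> = (\<Sum>\<beta><m. partial_deriv (Jet z J) (?w \<beta>) q * F \<beta> q)"
    proof (rule sum.cong[OF refl])
      fix \<beta> assume "\<beta> \<in> {..<m}"
      then have \<beta>: "\<beta> < m" by simp
      show "partial_deriv (Jet z J) (\<lambda>p. ?w \<beta> p * F \<beta> p) q = partial_deriv (Jet z J) (?w \<beta>) q * F \<beta> q"
        using partial_deriv_mult[OF df_smooth[OF dfw[OF \<beta>]] df_smooth[OF dfF[OF \<beta>]] that(2)]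
          partial_deriv_other_var_eq_0[OF dS[OF F[OF \<beta>]] that] by simp
    qed
    finally show ?thesis .
  qed
  have deriv_w: "partial_deriv c (?w \<beta>) q = (if c = Jet (V \<beta>) (\<lambda>_. 0) then 1 else 0) +
      (\<Sum>\<gamma><mt. if c = Jet (Vt \<gamma>) (\<lambda>_. 0) then 1 else 0)" if "q \<in> \<Omega>" for c \<beta> q
    using that by (simp add: multiplier_def[abs_def] partial_deriv_add partial_deriv_sum
        partial_deriv_coord smooth_sum smooth_coord)
  \<comment> \<open>The variable v with index \<beta> enters the single multiplier of index \<beta>
    and selects one equation, whereas each v~ enters every multiplier and therefore gives the sum of
    all equations below.\<close>
  have euler_V: "euler (V \<beta>) ?L q = F \<beta> q" if "\<beta> < m" "q \<in> \<Omega>" for \<beta> q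
    by (rule euler_eq_self[OF dfF[OF that(1)] dfL that(2)])
       (use that(1) in \<open>auto simp: deriv_L deriv_w if_distrib[of "\<lambda>x. x * _"] sum.delta cong: if_cong\<close>)
  have euler_Vt: "euler (Vt \<gamma>) ?L q = (\<Sum>\<nu><m. F \<nu> q)" if "\<gamma> < mt" "q \<in> \<Omega>" for \<gamma> q
    by (rule euler_eq_self[OF df_sum dfL that(2)])
       (use that(1) dfF in \<open>auto simp: deriv_L deriv_w sum.delta\<close>)

  show ?thesis
    unfolding Let_def
  proof (intro conjI allI impI)
    fix \<eta>s \<eta>ts
    assume "(\<forall>\<beta><m. df (\<eta>s \<beta>)) \<and> (\<forall>\<beta><mt. df (\<eta>ts \<beta>)) \<and>
      adjoint_coeff_relation \<Omega> n m mt \<xi> \<Lambda> \<eta>s \<eta>ts"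
    then have dfs: "\<And>\<beta>. \<beta> < m \<Longrightarrow> df (\<eta>s \<beta>)" and dfts: "\<And>\<beta>. \<beta> < mt \<Longrightarrow> df (\<eta>ts \<beta>)"
      and rel: "\<And>\<beta> q. \<beta> < m \<Longrightarrow> q \<in> \<Omega> \<Longrightarrow> \<eta>s \<beta> q + (\<Sum>\<alpha><mt. \<eta>ts \<alpha> q) =
        - ((\<Sum>\<alpha><m. ?w \<alpha> q * \<Lambda> \<alpha> \<beta> q) + ?w \<beta> q * total_div n ?Z \<xi> q)"
      unfolding adjoint_coeff_relation_multiplier by auto
    let ?Y = "Y_coeffs \<eta> \<eta>t \<eta>s \<eta>ts"
    have dfY: "df (?Y z)" if "z \<in> ?Z" for z
      using that dfs dfts diff_fun_subset[OF sub dS[OF eta]] diff_fun_subset[OF sub dS[OF etat]]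
      by (cases z) auto
    have prolong_F: "prolong n ?Z \<xi> ?Y (F \<alpha>) q = (\<Sum>\<beta><m. \<Lambda> \<alpha> \<beta> q * F \<beta> q)"
      if "\<alpha> < m" "q \<in> \<Omega>" for \<alpha> q
    proof -
      have "diff_fun \<Omega> n ?S (X_coeffs \<eta> \<eta>t z)" "?Y z = X_coeffs \<eta> \<eta>t z" if "z \<in> ?S" for z
        using that dS[OF eta] dS[OF etat] by (cases z; simp)+
      then have "prolong n ?S \<xi> (X_coeffs \<eta> \<eta>t) (F \<alpha>) q = prolong n ?Z \<xi> ?Y (F \<alpha>) q"
        using that dS[OF xi] dS[OF F] by (intro prolong_subset[OF sub]) auto
      then show ?thesis using symmetry[OF that] by simp
    qed
    have prolong_w: "prolong n ?Z \<xi> ?Y (?w \<beta>) q = \<eta>s \<beta> q + (\<Sum>\<gamma><mt. \<eta>ts \<gamma> q)"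
      if "\<beta> < m" "q \<in> \<Omega>" for \<beta> q
    proof -
      have dfVt: "df (dep_val (Vt \<gamma>))" if "\<gamma> \<in> {..<mt}" for \<gamma>
        using that by (intro df_jet) auto
      have "prolong n ?Z \<xi> ?Y (?w \<beta>) q = prolong n ?Z \<xi> ?Y (dep_val (V \<beta>)) q +
          prolong n ?Z \<xi> ?Y (\<lambda>p. \<Sum>\<gamma><mt. dep_val (Vt \<gamma>) p) q"
        unfolding multiplier_def[abs_def]
        using that by (intro prolong_add df_sum dfVt df_jet) auto
      also have "\<dots> = prolong n ?Z \<xi> ?Y (dep_val (V \<beta>)) q +
          (\<Sum>\<gamma><mt. prolong n ?Z \<xi> ?Y (dep_val (Vt \<gamma>)) q)"
        by (rule arg_cong2[where f = "(+)", OF refl prolong_sum[OF dfVt that(2)]])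
      also have "\<dots> = \<eta>s \<beta> q + (\<Sum>\<gamma><mt. \<eta>ts \<gamma> q)"
        using that by (simp add: prolong_dep_val)
      finally show ?thesis .
    qed
    have inv: "prolong n ?Z \<xi> ?Y ?L q + ?L q * total_div n ?Z \<xi> q = 0" if q: "q \<in> \<Omega>" for q
    proof -
      have "prolong n ?Z \<xi> ?Y ?L q = (\<Sum>\<beta><m.
          - ((\<Sum>\<alpha><m. ?w \<alpha> q * \<Lambda> \<alpha> \<beta> q) + ?w \<beta> q * total_div n ?Z \<xi> q) * F \<beta> q
          + ?w \<beta> q * (\<Sum>\<alpha><m. \<Lambda> \<beta> \<alpha> q * F \<alpha> q))"
      proof -
        have "prolong n ?Z \<xi> ?Y ?L q = (\<Sum>\<beta><m. prolong n ?Z \<xi> ?Y (\<lambda>p. ?w \<beta> p * F \<beta> p) q)"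
          unfolding adjoint_lagrangian_eq using q dfF dfw by (intro prolong_sum df_mult) auto
        also have "\<dots> = (\<Sum>\<beta><m.
          - ((\<Sum>\<alpha><m. ?w \<alpha> q * \<Lambda> \<alpha> \<beta> q) + ?w \<beta> q * total_div n ?Z \<xi> q) * F \<beta> q
          + ?w \<beta> q * (\<Sum>\<alpha><m. \<Lambda> \<beta> \<alpha> q * F \<alpha> q))"
        proof (rule sum.cong[OF refl])
          fix \<beta> assume "\<beta> \<in> {..<m}"
          then have \<beta>: "\<beta> < m" by simp
          show "prolong n ?Z \<xi> ?Y (\<lambda>p. ?w \<beta> p * F \<beta> p) q =
            - ((\<Sum>\<alpha><m. ?w \<alpha> q * \<Lambda> \<alpha> \<beta> q) + ?w \<beta> q * total_div n ?Z \<xi> q) * F \<beta> q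
            + ?w \<beta> q * (\<Sum>\<alpha><m. \<Lambda> \<beta> \<alpha> q * F \<alpha> q)"
            unfolding prolong_mult[OF dfw[OF \<beta>] dfF[OF \<beta>] q] prolong_w[OF \<beta> q] rel[OF \<beta> q]
              prolong_F[OF \<beta> q] by (rule refl)
        qed
        finally show ?thesis .
      qed
      also have "\<dots> = - (\<Sum>\<beta><m. \<Sum>\<alpha><m. ?w \<alpha> q * \<Lambda> \<alpha> \<beta> q * F \<beta> q) - ?L q * total_div n ?Z \<xi> q
          + (\<Sum>\<beta><m. \<Sum>\<alpha><m. ?w \<beta> q * \<Lambda> \<beta> \<alpha> q * F \<alpha> q)"
        by (simp add: adjoint_lagrangian_eq sum.distrib sum_subtractf sum_negf sum_distrib_left
            sum_distrib_right algebra_simps)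
      \<comment> \<open>The \<lambda> terms from prolonging the multipliers and those from
        prolonging the equations are the same double sum with the index names exchanged, so they
        cancel.\<close>
      also have "(\<Sum>\<beta><m. \<Sum>\<alpha><m. ?w \<beta> q * \<Lambda> \<beta> \<alpha> q * F \<alpha> q) =
          (\<Sum>\<beta><m. \<Sum>\<alpha><m. ?w \<alpha> q * \<Lambda> \<alpha> \<beta> q * F \<beta> q)"
        by (rule sum.swap)
      finally show ?thesis by simp
    qed
    show "admits_symmetry \<Omega> n ?Z (combined_system n m mt F) \<xi> ?Y"
      unfolding admits_symmetry_def
    proof (intro ballI impI)
      fix E p
      assume E: "E \<in> combined_system n m mt F" and p: "p \<in> \<Omega>"
        and "\<forall>G\<in>combined_system n m mt F. \<forall>J\<in>multi_indices n. DJ J G p = 0"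
      then have sol: "\<And>\<alpha> J. \<alpha> < m \<Longrightarrow> J \<in> multi_indices n \<Longrightarrow> DJ J (F \<alpha>) p = 0"
        "\<And>\<alpha> J. \<alpha> < m \<Longrightarrow> J \<in> multi_indices n \<Longrightarrow> DJ J (euler (U \<alpha>) ?L) p = 0"
        "\<And>\<alpha> J. \<alpha> < mt \<Longrightarrow> J \<in> multi_indices n \<Longrightarrow> DJ J (euler (Ut \<alpha>) ?L) p = 0"
        by (auto simp: combined_system_def adjoint_F_def adjoint_Ft_def)
      have F0: "F \<alpha> p = 0" if "\<alpha> < m" for \<alpha>
        using sol(1)[OF that zero_in_multi_indices] by simp
      \<comment> \<open>\<open>prolong_euler_eq_0\<close> needs all variational derivatives to
        vanish, not only the adjoint ones. In the v and v~ directions this is where the original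
        system has to be part of the combined one.\<close>
      have sol_euler: "DJ J (euler z ?L) p = 0" if z: "z \<in> ?Z" and J: "J \<in> multi_indices n" for z J
      proof (cases z)
        case (V \<beta>)
        then have "DJ J (euler z ?L) p = DJ J (F \<beta>) p"
          using z p by (intro total_deriv_mi_cong) (auto simp: euler_V)
        then show ?thesis using V z J sol(1) by simp
      next
        case (Vt \<gamma>)
        then have "DJ J (euler z ?L) p = DJ J (\<lambda>q. \<Sum>\<nu><m. F \<nu> q) p"
          using z p by (intro total_deriv_mi_cong) (auto simp: euler_Vt)
        also have "\<dots> = (\<Sum>\<nu><m. DJ J (F \<nu>) p)"
          using J p dfF by (intro total_deriv_mi_sum) auto
        also have "\<dots> = 0" using J sol(1) by simp
        finally show ?thesis .
      qed (use z J sol in auto)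
      have "prolong n ?Z \<xi> ?Y (euler z ?L) p = 0" if "z \<in> ?Z" for z
        using dfL dfxi dfY inv that p sol_euler by (rule prolong_euler_eq_0)
      moreover have "prolong n ?Z \<xi> ?Y (F \<alpha>) p = 0" if "\<alpha> < m" for \<alpha>
        using prolong_F[OF that p] F0 by simp
      ultimately show "prolong n ?Z \<xi> ?Y E p = 0"
        using E by (auto simp: combined_system_def adjoint_F_def adjoint_Ft_def)
    qed
  next
    fix \<beta> assume "\<beta> < m"
    then show "df (\<lambda>p. - ((\<Sum>\<alpha><m. (dep_val (V \<alpha>) p + (\<Sum>\<gamma><mt. dep_val (Vt \<gamma>) p)) * \<Lambda> \<alpha> \<beta> p)
        + dep_val (V \<beta>) p * total_div n ?Z \<xi> p))"
      using dfLambda dfdiv by (intro df_minus df_add df_sum df_mult df_jet) auto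
  next
    fix \<beta> assume "\<beta> < mt"
    then show "df (\<lambda>p. - dep_val (Vt \<beta>) p * total_div n ?Z \<xi> p)"
      using dfdiv by (intro df_minus df_mult df_jet) auto
  next
    \<comment> \<open>Summing the tilde coefficients adds the missing part of the multiplier in
      front of the divergence of \<xi>.\<close>
    show "adjoint_coeff_relation \<Omega> n m mt \<xi> \<Lambda>
      (\<lambda>\<beta> p. - ((\<Sum>\<alpha><m. (dep_val (V \<alpha>) p + (\<Sum>\<gamma><mt. dep_val (Vt \<gamma>) p)) * \<Lambda> \<alpha> \<beta> p)
        + dep_val (V \<beta>) p * total_div n ?Z \<xi> p))
      (\<lambda>\<alpha> p. - dep_val (Vt \<alpha>) p * total_div n ?Z \<xi> p)"
      unfolding adjoint_coeff_relation_multiplier multiplier_def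
      by (simp add: distrib_right sum_distrib_right sum_negf)
  qed
qed

end
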